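(* For every $\alpha\in(0,2]$, $$\mathcal{H}_\alpha=\mathbb{E}\left\{\frac{1}{\int_{\mathbb{R}}\mathbb{I}_0\left(W_\alpha(s)+\mathcal{E}\right)\,ds}\right\}\ \ge\ \frac{\Gamma(1/\alpha)}{4\,\Gamma(2/\alpha)} .$$
   Context: $\Gamma(\cdot)$ is the Euler Gamma function. For $\alpha\in(0,2]$, $B_\alpha(t)$, $t\in\mathbb{R}$, is a standard (two-sided, continuous-path) fractional Brownian motion with Hurst index $\alpha/2\in(0,1]$, and $W_\alpha(t):=\sqrt{2}B_\alpha(t)-|t|^\alpha$. $\mathcal{E}$ is a unit-mean exponential random variable independent of $W_\alpha$. $\mathbb{I}_0(x):=\mathbb{I}(x>0)$ is the indicator that $x>0$. The Pickands constant is $$\mathcal{H}_\alpha=\lim_{S\to\infty}S^{-1}\,\mathbb{E}\left\{\sup_{t\in[0,S]}e^{W_\alpha(t)}\right\}\in(0,\infty).$$ *)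

theory Defs
  imports "HOL-Probability.Probability"
begin

text \<open>The real random variable \<open>X\<close> has law \<open>N(\<mu>, \<sigma>\<^sup>2)\<close>; the degenerate case \<open>\<sigma> = 0\<close> (a point mass) is
  included, as is required for linear combinations of a Gaussian family.\<close>

definition normal_rv :: "'w measure \<Rightarrow> ('w \<Rightarrow> real) \<Rightarrow> real \<Rightarrow> real \<Rightarrow> bool" where
  "normal_rv M X \<mu> \<sigma> \<longleftrightarrow>
     X \<in> borel_measurable M \<and> 0 \<le> \<sigma> \<and>
     (if \<sigma> = 0 then (AE \<omega> in M. X \<omega> = \<mu>)
      else distributed M lborel X (\<lambda>x. ennreal (normal_density \<mu> \<sigma> x)))"

definition gaussian_process :: "'w measure \<Rightarrow> ('t \<Rightarrow> 'w \<Rightarrow> real) \<Rightarrow> bool" where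
  "gaussian_process M X \<longleftrightarrow>
     (\<forall>(T :: 't set) (c :: 't \<Rightarrow> real). finite T \<longrightarrow>
        (\<exists>\<mu> \<sigma>. normal_rv M (\<lambda>\<omega>. \<Sum>t\<in>T. c t * X t \<omega>) \<mu> \<sigma>))"

text \<open>Standard (\<open>Var (B 1) = 1\<close>), two-sided, with every path continuous; \<open>H\<close> is the Hurst index.\<close>

definition fractional_brownian_motion ::
  "'w measure \<Rightarrow> real \<Rightarrow> (real \<Rightarrow> 'w \<Rightarrow> real) \<Rightarrow> bool" where
  "fractional_brownian_motion M H B \<longleftrightarrow>
     prob_space M \<and> 0 < H \<and> H \<le> 1 \<and>
     gaussian_process M B \<and>
     (\<forall>t. prob_space.expectation M (B t) = 0) \<and>
     (\<forall>s t. prob_space.expectation M (\<lambda>\<omega>. B s \<omega> * B t \<omega>) =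
        (\<bar>s\<bar> powr (2 * H) + \<bar>t\<bar> powr (2 * H) - \<bar>s - t\<bar> powr (2 * H)) / 2) \<and>
     (\<forall>\<omega>\<in>space M. continuous_on UNIV (\<lambda>t. B t \<omega>))"

definition W_process :: "real \<Rightarrow> (real \<Rightarrow> 'w \<Rightarrow> real) \<Rightarrow> real \<Rightarrow> 'w \<Rightarrow> real" where
  "W_process \<alpha> B t \<omega> = sqrt 2 * B t \<omega> - \<bar>t\<bar> powr \<alpha>"

text \<open>The value depends only on \<open>\<alpha>\<close> when \<open>B\<close> is a fractional Brownian motion with Hurst index
  \<open>\<alpha> / 2\<close>, since it is determined by the finite-dimensional laws of \<open>B\<close>.\<close>

definition pickands_constant :: "'w measure \<Rightarrow> real \<Rightarrow> (real \<Rightarrow> 'w \<Rightarrow> real) \<Rightarrow> real" where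
  "pickands_constant M \<alpha> B =
     Lim at_top (\<lambda>S::real. inverse S *
       prob_space.expectation M (\<lambda>\<omega>. SUP t\<in>{0..S}. exp (W_process \<alpha> B t \<omega>)))"

text \<open>Independence of a real random variable from a whole process, i.e. of the generated
  \<open>\<sigma>\<close>-algebras. The library's \<open>indep_var\<close> does not apply because it requires both random
  elements to have the same value type.\<close>

definition indep_of_process ::
  "'w measure \<Rightarrow> ('w \<Rightarrow> real) \<Rightarrow> (real \<Rightarrow> 'w \<Rightarrow> real) \<Rightarrow> bool" where
  "indep_of_process M Y X \<longleftrightarrow>
     prob_space.indep_set M
       (sets (vimage_algebra (space M) Y borel))
       (sets (vimage_algebra (space M) (\<lambda>\<omega> t. X t \<omega>) (\<Pi>\<^sub>M t\<in>UNIV. borel)))"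

text \<open>The sojourn time \<open>\<integral> I\<^sub>0 (W(s) + y) ds\<close>, where \<open>I\<^sub>0\<close> is the indicator of \<open>{0<..}\<close>. If it is infinite, the
  Bochner integral is \<open>0\<close>, and \<open>1 / 0 = 0\<close> then agrees with the convention \<open>1 / \<infinity> = 0\<close>.\<close>

definition sojourn_time :: "real \<Rightarrow> (real \<Rightarrow> 'w \<Rightarrow> real) \<Rightarrow> real \<Rightarrow> 'w \<Rightarrow> real" where
  "sojourn_time \<alpha> B y \<omega> =
     (LINT s|lborel. indicator {0<..} (W_process \<alpha> B s \<omega> + y))"

end

theory Submission
  imports Defs "HOL-Complex_Analysis.Conformal_Mappings"
begin

text \<open>Write \<open>W(t) = sqrt 2 B(t) - |t|^\<alpha>\<close>. Two facts carry the proof.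

Tilting. Since \<open>B\<close> is Gaussian with stationary increments, weighting the probability by \<open>exp (W s)\<close> turns
the law of \<open>W - W s\<close> into the law of the shifted process \<open>W(\<cdot> - s)\<close>. On the level of exponential moments this is
the observation that \<open>E exp (\<Sum> d\<^sub>t W(t))\<close> with \<open>\<Sum> d\<^sub>t = 1\<close> depends only on the differences of the times
(\<open>exp_moment_W\<close>). Equality of exponential moments gives equality of laws (\<open>process_law_eqI_mgf\<close>), and
\<open>tilted_law\<close> follows.

Sojourn representation. For a continuous path, \<open>exp (sup W)\<close> is the integral of \<open>exp (- y)\<close> over the levels
\<open>y\<close> at which \<open>W + y\<close> becomes positive on \<open>[0, S]\<close>. At such a level the time that \<open>W + y\<close> spends above \<open>0\<close>,
divided by itself, is \<open>1\<close>. Inserting this quotient, substituting \<open>y = z - W s\<close> and tilting by \<open>exp (W s)\<close> gives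
\<open>E sup exp W = \<integral>\<^sub>0\<^sup>S G(- s, S - s) ds\<close>, where \<open>G(a, b)\<close> is the expected reciprocal of the time in \<open>[a, b]\<close> that
\<open>W + Z\<close> spends above \<open>0\<close>, for \<open>Z\<close> exponential and independent (\<open>nn_integral_exp_sup\<close>).

Since \<open>G\<close> decreases as the window grows, the right-hand side is at least \<open>S G(\<real>)\<close>, and cutting off the two ends
of \<open>[0, S]\<close> bounds it by \<open>2 A(R) + S G(- R, R)\<close> with \<open>A(R)\<close> the expected supremum over \<open>[0, R]\<close>. A chaining bound makes \<open>E sup exp W\<close> finite
(\<open>nn_integral_exp_sup_finite\<close>), which provides the domination for \<open>G(- R, R) \<rightarrow> G(\<real>)\<close>. Dividing by \<open>S\<close>,
the limit that defines the Pickands constant is \<open>G(\<real>)\<close>, and this is the expectation in the theorem.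

For the lower bound, \<open>E (1 / L) \<ge> 1 / E L\<close> for the sojourn time \<open>L\<close>, and \<open>E L\<close> is explicit: the probability that
\<open>W s + Z > 0\<close> is \<open>E min(1, exp (W s)) = 2 P(N > |s|^(\<alpha>/2) / sqrt 2)\<close> with \<open>N\<close> standard normal. Its integral over
\<open>s\<close> is an absolute moment of \<open>N\<close>, which the duplication formula turns into \<open>4 \<Gamma>(2/\<alpha>) / \<Gamma>(1/\<alpha>)\<close>
(\<open>mean_sojourn\<close>).\<close>

section \<open>Laws determined by exponential moments\<close>

text \<open>Expanding the exponential and integrating term by term is licensed by the integrability of
\<open>exp (|z| |x|)\<close>, which two real exponential moments dominate. The point is that the complex moment generating
function is given by one power series on the whole plane, hence entire.\<close>

lemma mgf_power_series:
  fixes \<mu> :: "real measure"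
  assumes "real_distribution \<mu>"
    and int: "\<And>u. integrable \<mu> (\<lambda>x. exp (u * x))"
  shows "(\<lambda>n. (\<integral>x. complex_of_real (x ^ n / fact n) \<partial>\<mu>) * z ^ n) sums
           (\<integral>x. exp (z * of_real x) \<partial>\<mu>)"
proof -
  interpret real_distribution \<mu> by fact
  define f where "f n x = z ^ n * complex_of_real (x ^ n / fact n)" for n and x :: real
  have norm_f: "norm (f n x) = (norm z * \<bar>x\<bar>) ^ n / fact n" for n x
    by (simp add: f_def norm_mult norm_divide norm_power power_mult_distrib power_abs)
  have sums_exp: "(\<lambda>n. f n x) sums exp (z * of_real x)" for x
    using exp_converges[of "z * complex_of_real x"]
    by (simp add: f_def scaleR_conv_of_real field_simps)
  have sums_norm: "(\<lambda>n. norm (f n x)) sums exp (norm z * \<bar>x\<bar>)" for x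
    using exp_converges[of "norm z * \<bar>x\<bar>"] by (simp add: norm_f field_simps)
  have int_abs: "integrable \<mu> (\<lambda>x. exp (norm z * \<bar>x\<bar>))"
  proof (rule Bochner_Integration.integrable_bound)
    show "integrable \<mu> (\<lambda>x. exp (norm z * x) + exp (- norm z * x))"
      using int[of "norm z"] int[of "- norm z"] by (rule Bochner_Integration.integrable_add)
    show "AE x in \<mu>. norm (exp (norm z * \<bar>x\<bar>)) \<le> norm (exp (norm z * x) + exp (- norm z * x))"
    proof (rule AE_I2)
      fix x
      have "exp (norm z * \<bar>x\<bar>) \<le> exp (norm z * x) + exp (- norm z * x)"
        using exp_ge_zero[of "norm z * x"] exp_ge_zero[of "- norm z * x"] by (cases "0 \<le> x") auto
      then show "norm (exp (norm z * \<bar>x\<bar>)) \<le> norm (exp (norm z * x) + exp (- norm z * x))"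
        by simp
    qed
  qed simp
  have int_f: "integrable \<mu> (f n)" for n
  proof (rule Bochner_Integration.integrable_bound[OF int_abs])
    have "norm (f n x) \<le> exp (norm z * \<bar>x\<bar>)" for x
      using sum_le_suminf[OF sums_summable[OF sums_norm[of x]], of "{n}"] sums_unique[OF sums_norm[of x]]
      by simp
    then show "AE x in \<mu>. norm (f n x) \<le> norm (exp (norm z * \<bar>x\<bar>))" by simp
  qed (simp add: f_def[abs_def])
  have "summable (\<lambda>n. \<integral>x. norm (f n x) \<partial>\<mu>)"
  proof (rule summableI_nonneg_bounded)
    fix n
    have "(\<Sum>i<n. \<integral>x. norm (f i x) \<partial>\<mu>) = (\<integral>x. (\<Sum>i<n. norm (f i x)) \<partial>\<mu>)"
      using int_f by (simp add: Bochner_Integration.integral_sum)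
    also have "\<dots> \<le> (\<integral>x. exp (norm z * \<bar>x\<bar>) \<partial>\<mu>)"
    proof (rule integral_mono)
      show "(\<Sum>i<n. norm (f i x)) \<le> exp (norm z * \<bar>x\<bar>)" for x
        using sum_le_suminf[OF sums_summable[OF sums_norm[of x]], of "{..<n}"]
          sums_unique[OF sums_norm[of x]] by simp
    qed (use int_f int_abs in auto)
    finally show "(\<Sum>i<n. \<integral>x. norm (f i x) \<partial>\<mu>) \<le> (\<integral>x. exp (norm z * \<bar>x\<bar>) \<partial>\<mu>)" .
  qed (simp add: integral_nonneg)
  then have "(\<lambda>n. integral\<^sup>L \<mu> (f n)) sums (\<integral>x. (\<Sum>n. f n x) \<partial>\<mu>)"
    using int_f sums_norm by (intro sums_integral) (auto intro: sums_summable)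
  moreover have "(\<Sum>n. f n x) = exp (z * of_real x)" for x
    using sums_unique[OF sums_exp[of x]] by simp
  moreover have "integral\<^sup>L \<mu> (f n) = (\<integral>x. complex_of_real (x ^ n / fact n) \<partial>\<mu>) * z ^ n" for n
    unfolding f_def by (subst integral_mult_right_zero) simp
  ultimately show ?thesis by simp
qed

text \<open>Both moment generating functions are entire and agree on the real axis, so they agree on the imaginary
axis, where they are the characteristic functions.\<close>

lemma real_distribution_eqI_mgf:
  assumes "real_distribution \<mu>" and "real_distribution \<nu>"
    and int: "\<And>u. integrable \<mu> (\<lambda>x. exp (u * x))" "\<And>u. integrable \<nu> (\<lambda>x. exp (u * x))"
    and eq: "\<And>u. (\<integral>x. exp (u * x) \<partial>\<mu>) = (\<integral>x. exp (u * x) \<partial>\<nu>)"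
  shows "\<mu> = \<nu>"
proof (rule Levy_uniqueness[OF assms(1,2)])
  define f where "f \<kappa> z = (\<integral>x. exp (z * complex_of_real x) \<partial>\<kappa>)" for \<kappa> :: "real measure" and z
  have hol: "f \<kappa> holomorphic_on UNIV"
    if "real_distribution \<kappa>" "\<And>u. integrable \<kappa> (\<lambda>x. exp (u * x))" for \<kappa>
  proof -
    have "f \<kappa> holomorphic_on ball 0 r" for r
      by (rule power_series_holomorphic[where a = "\<lambda>n. \<integral>x. complex_of_real (x ^ n / fact n) \<partial>\<kappa>"])
        (use mgf_power_series[OF that] in \<open>simp add: f_def\<close>)
    then have "f \<kappa> field_differentiable (at z)" for z
      using holomorphic_on_imp_differentiable_at[of "f \<kappa>" "ball 0 (norm z + 1)" z] by simp
    then show ?thesis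
      by (auto simp: holomorphic_on_def intro: field_differentiable_at_within)
  qed
  have real: "f \<kappa> (of_real u) = of_real (\<integral>x. exp (u * x) \<partial>\<kappa>)" for u \<kappa>
    unfolding f_def by (subst integral_complex_of_real[symmetric]) (simp flip: exp_of_real)
  have "f \<mu> z - f \<nu> z = 0" for z
  proof (rule analytic_continuation[where f = "\<lambda>z. f \<mu> z - f \<nu> z" and U = "range complex_of_real" and S = UNIV and \<xi> = 0])
    show "(\<lambda>z. f \<mu> z - f \<nu> z) holomorphic_on UNIV"
      using hol[OF assms(1) int(1)] hol[OF assms(2) int(2)] by (rule holomorphic_on_diff)
    show "0 islimpt range complex_of_real"
      unfolding islimpt_approachable
    proof (intro allI impI)
      fix e :: real assume "0 < e"
      then show "\<exists>x'\<in>range complex_of_real. x' \<noteq> 0 \<and> dist x' 0 < e"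
        by (intro bexI[of _ "complex_of_real (e / 2)"] rangeI) (auto simp: norm_divide)
    qed
    show "f \<mu> z - f \<nu> z = 0" if "z \<in> range complex_of_real" for z
      using that eq by (auto simp: real)
  qed auto
  then have rotated: "f \<mu> (\<i> * of_real t) = f \<nu> (\<i> * of_real t)" for t
    by simp
  show "char \<mu> = char \<nu>"
  proof (rule ext)
    show "char \<mu> t = char \<nu> t" for t
      using rotated[of t] by (simp add: char_def f_def mult.assoc)
  qed
qed

text \<open>Uniqueness theorems speak of probability laws; a weighted law is reduced to one by dividing by its mass.\<close>

lemma normalized_weight_law:
  fixes X :: "'a \<Rightarrow> real" and h :: "real \<Rightarrow> real"
  assumes [measurable]: "X \<in> borel_measurable M" "h \<in> borel_measurable borel"
    and int_v: "integrable M v" and nonneg: "\<And>x. 0 \<le> v x" and pos: "0 < (\<integral>x. v x \<partial>M)"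
  defines "m \<equiv> \<integral>x. v x \<partial>M"
  defines "\<mu> \<equiv> distr (density M (\<lambda>x. ennreal (v x / m))) borel X"
  shows "real_distribution \<mu>"
    and "(\<integral>x. h x \<partial>\<mu>) = (\<integral>x. v x * h (X x) \<partial>M) / m"
    and "integrable M (\<lambda>x. v x * h (X x)) \<Longrightarrow> integrable \<mu> h"
proof -
  have [measurable]: "v \<in> borel_measurable M" using int_v by simp
  have m: "0 < m" using pos by (simp add: m_def)
  have "emeasure (density M (\<lambda>x. ennreal (v x / m))) (space M) = (\<integral>\<^sup>+x. ennreal (v x / m) \<partial>M)"
    by (subst emeasure_density) (auto intro!: nn_integral_cong)
  also have "\<dots> = ennreal ((\<integral>x. v x \<partial>M) / m)"
    using int_v nonneg m by (subst nn_integral_eq_integral) auto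
  also have "\<dots> = 1" using m by (simp add: m_def)
  finally interpret D: prob_space "density M (\<lambda>x. ennreal (v x / m))"
    by (intro prob_spaceI) simp
  show "real_distribution \<mu>"
    unfolding \<mu>_def by (rule D.real_distribution_distr) simp
  show "(\<integral>x. h x \<partial>\<mu>) = (\<integral>x. v x * h (X x) \<partial>M) / m"
    using nonneg m unfolding \<mu>_def
    by (simp add: integral_distr integral_density)
  show "integrable \<mu> h" if "integrable M (\<lambda>x. v x * h (X x))"
    using nonneg m that unfolding \<mu>_def
    by (simp add: integrable_distr_eq integrable_density)
qed

text \<open>The version with weights serves as the induction step for several coordinates: the weight collects the
factors that depend on the other coordinates.\<close>

lemma weighted_law_eqI_mgf:
  fixes X :: "'a \<Rightarrow> real" and Y :: "'b \<Rightarrow> real"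
  assumes meas [measurable]: "X \<in> borel_measurable M" "Y \<in> borel_measurable N" "A \<in> sets borel"
    and nonneg: "\<And>x. 0 \<le> v x" "\<And>y. 0 \<le> w y"
    and int: "\<And>u. integrable M (\<lambda>x. v x * exp (u * X x))" "\<And>u. integrable N (\<lambda>y. w y * exp (u * Y y))"
    and eq: "\<And>u. (\<integral>x. v x * exp (u * X x) \<partial>M) = (\<integral>y. w y * exp (u * Y y) \<partial>N)"
  shows "(\<integral>x. v x * indicator A (X x) \<partial>M) = (\<integral>y. w y * indicator A (Y y) \<partial>N)"
proof -
  define m where "m = (\<integral>x. v x \<partial>M)"
  have int_v: "integrable M v" "integrable N w" using int[of 0] by simp_all
  have m_w: "m = (\<integral>y. w y \<partial>N)" using eq[of 0] by (simp add: m_def)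
  show ?thesis
  proof (cases "m = 0")
    case True
    then have "AE x in M. v x = 0" "AE y in N. w y = 0"
      using int_v nonneg m_w
      by (simp_all add: m_def integral_nonneg_eq_0_iff_AE[symmetric])
    then have "(\<integral>x. v x * indicator A (X x) \<partial>M) = 0" "(\<integral>y. w y * indicator A (Y y) \<partial>N) = 0"
      by (auto intro!: integral_eq_zero_AE)
    then show ?thesis by simp
  next
    case False
    then have m_pos: "0 < (\<integral>x. v x \<partial>M)" "0 < (\<integral>y. w y \<partial>N)"
      using Bochner_Integration.integral_nonneg[of M v] nonneg
      by (simp_all add: m_w[symmetric] m_def[symmetric] order.not_eq_order_implies_strict)
    note V = normalized_weight_law[OF meas(1) _ int_v(1) nonneg(1) m_pos(1)]
    note W = normalized_weight_law[OF meas(2) _ int_v(2) nonneg(2) m_pos(2)]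
    let ?\<mu> = "distr (density M (\<lambda>x. ennreal (v x / m))) borel X"
    let ?\<nu> = "distr (density N (\<lambda>y. ennreal (w y / m))) borel Y"
    note V = V[folded m_def] and W = W[folded m_w]
    have "?\<mu> = ?\<nu>"
    proof (rule real_distribution_eqI_mgf)
      show "real_distribution ?\<mu>" by (rule V(1)[of "\<lambda>_. 0"]) simp
      show "real_distribution ?\<nu>" by (rule W(1)[of "\<lambda>_. 0"]) simp
      show "integrable ?\<mu> (\<lambda>x. exp (u * x))" for u by (rule V(3)) (use int in simp_all)
      show "integrable ?\<nu> (\<lambda>x. exp (u * x))" for u by (rule W(3)) (use int in simp_all)
      show "(\<integral>x. exp (u * x) \<partial>?\<mu>) = (\<integral>x. exp (u * x) \<partial>?\<nu>)" for u
        using V(2)[of "\<lambda>x. exp (u * x)"] W(2)[of "\<lambda>x. exp (u * x)"] eq[of u] by simp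
    qed
    then have "(\<integral>x. v x * indicator A (X x) \<partial>M) / m = (\<integral>y. w y * indicator A (Y y) \<partial>N) / m"
      using V(2)[of "indicator A"] W(2)[of "indicator A"] by simp
    with False show ?thesis by simp
  qed
qed

text \<open>A Cramer--Wold principle for real exponential moments. Real exponentials are positive, so all factors
except the one of a single coordinate can be treated as a weight, and the one-dimensional uniqueness theorem
replaces the exponential of that coordinate by an indicator. Doing this for finitely many coordinates yields the
probabilities of all cylinder boxes, which determine the law on the product space.\<close>

lemma process_law_eqI_mgf:
  fixes X :: "'t \<Rightarrow> 'a \<Rightarrow> real" and Y :: "'t \<Rightarrow> 'b \<Rightarrow> real"
  assumes "prob_space M" "prob_space N"
    and meas [measurable]: "\<And>t. X t \<in> borel_measurable M" "\<And>t. Y t \<in> borel_measurable N"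
    and int: "\<And>T c. finite T \<Longrightarrow> integrable M (\<lambda>x. exp (\<Sum>t\<in>T. c t * X t x))"
      "\<And>T c. finite T \<Longrightarrow> integrable N (\<lambda>y. exp (\<Sum>t\<in>T. c t * Y t y))"
    and eq: "\<And>T c. finite T \<Longrightarrow>
      (\<integral>x. exp (\<Sum>t\<in>T. c t * X t x) \<partial>M) = (\<integral>y. exp (\<Sum>t\<in>T. c t * Y t y) \<partial>N)"
  shows "distr M (\<Pi>\<^sub>M t\<in>UNIV. borel) (\<lambda>x t. X t x) = distr N (\<Pi>\<^sub>M t\<in>UNIV. borel) (\<lambda>y t. Y t y)"
proof -
  interpret M: prob_space M by fact
  interpret N: prob_space N by fact
  have add: "(\<Sum>t\<in>T. c t * Z t z) + u * Z j z
      = (\<Sum>t\<in>insert j T. ((if t \<in> T then c t else 0) + (if t = j then u else 0)) * Z t z)"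
    if "finite T" for T and c :: "'t \<Rightarrow> real" and Z :: "'t \<Rightarrow> 'z \<Rightarrow> real" and u j z
  proof -
    have "(\<Sum>t\<in>insert j T. (if t \<in> T then c t else 0) * Z t z) = (\<Sum>t\<in>T. c t * Z t z)"
      using that by (intro sum.mono_neutral_cong_right) auto
    moreover have "(\<Sum>t\<in>insert j T. (if t = j then u else 0) * Z t z) = u * Z j z"
      using that by (subst sum.cong[OF refl, of _ _ "\<lambda>t. if t = j then u * Z j z else 0"]) auto
    ultimately show ?thesis by (simp add: sum.distrib distrib_right)
  qed
  have int_ind: "integrable K (\<lambda>x. (\<Prod>j\<in>J. indicator (A j) (Z j x)) * exp (\<Sum>t\<in>T. c t * Z t x))"
    if "finite J" "\<And>j. Z j \<in> borel_measurable K" "\<And>j. A j \<in> sets borel"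
      "integrable K (\<lambda>x. exp (\<Sum>t\<in>T. c t * Z t x))"
    for K :: "'z measure" and Z :: "'t \<Rightarrow> 'z \<Rightarrow> real" and J A T c
  proof (rule Bochner_Integration.integrable_bound[OF that(4)])
    note that(2,3)[measurable]
    show "(\<lambda>x. (\<Prod>j\<in>J. indicator (A j) (Z j x)) * exp (\<Sum>t\<in>T. c t * Z t x)) \<in> borel_measurable K"
      by measurable
    show "AE x in K. norm ((\<Prod>j\<in>J. indicator (A j) (Z j x)) * exp (\<Sum>t\<in>T. c t * Z t x))
        \<le> norm (exp (\<Sum>t\<in>T. c t * Z t x))"
      by (intro AE_I2) (auto simp: abs_mult abs_prod intro!: mult_left_le_one_le prod_le_1 prod_nonneg)
  qed
  \<comment> \<open>Each step trades the exponential factor of one coordinate for an indicator; \<open>c\<close> stays arbitrary because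
    the factor \<open>exp (u * X j x)\<close> is absorbed into the linear combination.\<close>
  have box: "(\<integral>x. (\<Prod>j\<in>J. indicator (A j) (X j x)) * exp (\<Sum>t\<in>T. c t * X t x) \<partial>M)
      = (\<integral>y. (\<Prod>j\<in>J. indicator (A j) (Y j y)) * exp (\<Sum>t\<in>T. c t * Y t y) \<partial>N)"
    if "finite J" "finite T" "\<And>j. A j \<in> sets borel" for J T c A
    using that(1,2)
  proof (induction J arbitrary: T c)
    case empty
    then show ?case using eq by simp
  next
    case (insert j J)
    let ?v = "\<lambda>x. (\<Prod>j\<in>J. indicator (A j) (X j x)) * exp (\<Sum>t\<in>T. c t * X t x)"
    let ?w = "\<lambda>y. (\<Prod>j\<in>J. indicator (A j) (Y j y)) * exp (\<Sum>t\<in>T. c t * Y t y)"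
    have "(\<integral>x. ?v x * indicator (A j) (X j x) \<partial>M) = (\<integral>y. ?w y * indicator (A j) (Y j y) \<partial>N)"
    proof (rule weighted_law_eqI_mgf)
      show "integrable M (\<lambda>x. ?v x * exp (u * X j x))" for u
        using int_ind[of J X M A _ "insert j T"] insert.hyps insert.prems that(3) int(1)
        by (simp add: mult.assoc exp_add[symmetric] add)
      show "integrable N (\<lambda>y. ?w y * exp (u * Y j y))" for u
        using int_ind[of J Y N A _ "insert j T"] insert.hyps insert.prems that(3) int(2)
        by (simp add: mult.assoc exp_add[symmetric] add)
      show "(\<integral>x. ?v x * exp (u * X j x) \<partial>M) = (\<integral>y. ?w y * exp (u * Y j y) \<partial>N)" for u
        using insert.IH[of "insert j T"] insert.prems
        by (simp add: mult.assoc exp_add[symmetric] add)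
    qed (use that(3) in \<open>auto intro!: prod_nonneg mult_nonneg_nonneg\<close>)
    then show ?case
      using insert.hyps by (simp add: mult_ac)
  qed
  have cyl: "emeasure (distr K (\<Pi>\<^sub>M t\<in>UNIV. borel) (\<lambda>x t. Z t x)) (prod_emb UNIV (\<lambda>_. borel) J (Pi\<^sub>E J A))
      = ennreal (\<integral>x. (\<Prod>j\<in>J. indicator (A j) (Z j x)) \<partial>K)"
    if "prob_space K" "finite J" "\<And>j. Z j \<in> borel_measurable K" "\<And>j. j \<in> J \<Longrightarrow> A j \<in> sets borel"
    for K :: "'z measure" and Z :: "'t \<Rightarrow> 'z \<Rightarrow> real" and J A
  proof -
    interpret K: prob_space K by fact
    note that(3)[measurable]
    have S: "{x \<in> space K. \<forall>j\<in>J. Z j x \<in> A j} \<in> sets K"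
      using that(2,4) by measurable
    have "emeasure (distr K (\<Pi>\<^sub>M t\<in>UNIV. borel) (\<lambda>x t. Z t x)) (prod_emb UNIV (\<lambda>_. borel) J (Pi\<^sub>E J A))
        = emeasure K {x \<in> space K. \<forall>j\<in>J. Z j x \<in> A j}"
      using that(2,4)
    proof (subst emeasure_distr)
      show "prod_emb UNIV (\<lambda>_. borel) J (Pi\<^sub>E J A) \<in> sets (\<Pi>\<^sub>M t\<in>UNIV. borel)"
        using that(2,4) by (intro sets_PiM_I) auto
      show "(\<lambda>x t. Z t x) \<in> measurable K (\<Pi>\<^sub>M t\<in>UNIV. borel)"
        by (rule measurable_PiM_single') auto
      have "(\<lambda>x t. Z t x) -` prod_emb UNIV (\<lambda>_. borel) J (Pi\<^sub>E J A) \<inter> space K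
          = {x \<in> space K. \<forall>j\<in>J. Z j x \<in> A j}"
        by (auto simp: prod_emb_iff PiE_iff)
      then show "emeasure K ((\<lambda>x t. Z t x) -` prod_emb UNIV (\<lambda>_. borel) J (Pi\<^sub>E J A) \<inter> space K)
          = emeasure K {x \<in> space K. \<forall>j\<in>J. Z j x \<in> A j}"
        by simp
    qed
    also have "\<dots> = ennreal (\<integral>x. indicator {x \<in> space K. \<forall>j\<in>J. Z j x \<in> A j} x \<partial>K)"
      using S by (simp add: K.emeasure_eq_measure)
    also have "(\<integral>x. indicator {x \<in> space K. \<forall>j\<in>J. Z j x \<in> A j} x \<partial>K)
        = (\<integral>x. (\<Prod>j\<in>J. indicator (A j) (Z j x) :: real) \<partial>K)"
    proof (rule Bochner_Integration.integral_cong[OF refl])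
      fix x assume x: "x \<in> space K"
      show "indicator {x \<in> space K. \<forall>j\<in>J. Z j x \<in> A j} x = (\<Prod>j\<in>J. indicator (A j) (Z j x) :: real)"
      proof (cases "\<forall>j\<in>J. Z j x \<in> A j")
        case False
        then have "(\<Prod>j\<in>J. indicator (A j) (Z j x) :: real) = 0"
          using that(2) by (intro prod_zero) (auto simp: indicator_eq_0_iff)
        with False show ?thesis by simp
      qed (use x in simp)
    qed
    finally show ?thesis .
  qed
  show ?thesis
  proof (rule measure_eqI_PiM_infinite[where I = UNIV and M = "\<lambda>_. borel"])
    fix A :: "'t \<Rightarrow> real set" and J :: "'t set" assume J: "finite J" and A: "\<And>i. i \<in> J \<Longrightarrow> A i \<in> sets borel"
    \<comment> \<open>Outside \<open>J\<close> the sets are arbitrary; \<open>box\<close> asks for Borel sets at every index.\<close>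
    define A' where "A' j = (if j \<in> J then A j else UNIV)" for j
    have "A' j \<in> sets borel" for j using A by (simp add: A'_def)
    then have "(\<integral>x. (\<Prod>j\<in>J. indicator (A' j) (X j x)) \<partial>M) = (\<integral>y. (\<Prod>j\<in>J. indicator (A' j) (Y j y) :: real) \<partial>N)"
      using box[OF J, of "{}" A'] by simp
    then have "(\<integral>x. (\<Prod>j\<in>J. indicator (A j) (X j x)) \<partial>M) = (\<integral>y. (\<Prod>j\<in>J. indicator (A j) (Y j y) :: real) \<partial>N)"
      by (simp add: A'_def cong: prod.cong)
    then show "emeasure (distr M (\<Pi>\<^sub>M t\<in>UNIV. borel) (\<lambda>x t. X t x)) (prod_emb UNIV (\<lambda>_. borel) J (Pi\<^sub>E J A))
        = emeasure (distr N (\<Pi>\<^sub>M t\<in>UNIV. borel) (\<lambda>y t. Y t y)) (prod_emb UNIV (\<lambda>_. borel) J (Pi\<^sub>E J A))"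
      using cyl[OF assms(1) J meas(1) A] cyl[OF assms(2) J meas(2) A] by simp
  next
    show "finite_measure (distr M (\<Pi>\<^sub>M t\<in>UNIV. borel) (\<lambda>x t. X t x))"
      by (intro M.finite_measure_distr measurable_PiM_single') auto
  qed simp_all
qed

section \<open>Moments of normal random variables\<close>

text \<open>Completing the square: the exponential tilt of a normal density is a shifted normal density.\<close>

lemma nn_integral_exp_normal_density:
  assumes "0 < \<sigma>"
  shows "(\<integral>\<^sup>+x. ennreal (normal_density \<mu> \<sigma> x) * ennreal (exp x) \<partial>lborel) = ennreal (exp (\<mu> + \<sigma>\<^sup>2 / 2))"
proof -
  have "normal_density \<mu> \<sigma> x * exp x = exp (\<mu> + \<sigma>\<^sup>2 / 2) * normal_density (\<mu> + \<sigma>\<^sup>2) \<sigma> x" for x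
  proof -
    have "- (x - \<mu>)\<^sup>2 / (2 * \<sigma>\<^sup>2) + x = \<mu> + \<sigma>\<^sup>2 / 2 + - (x - (\<mu> + \<sigma>\<^sup>2))\<^sup>2 / (2 * \<sigma>\<^sup>2)"
      using assms by (simp add: field_simps power2_eq_square)
    then have "exp (- (x - \<mu>)\<^sup>2 / (2 * \<sigma>\<^sup>2)) * exp x
        = exp (\<mu> + \<sigma>\<^sup>2 / 2) * exp (- (x - (\<mu> + \<sigma>\<^sup>2))\<^sup>2 / (2 * \<sigma>\<^sup>2))"
      by (simp flip: exp_add)
    then show ?thesis by (simp add: normal_density_def)
  qed
  then have "(\<integral>\<^sup>+x. ennreal (normal_density \<mu> \<sigma> x) * ennreal (exp x) \<partial>lborel)
      = (\<integral>\<^sup>+x. ennreal (exp (\<mu> + \<sigma>\<^sup>2 / 2)) * ennreal (normal_density (\<mu> + \<sigma>\<^sup>2) \<sigma> x) \<partial>lborel)"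
    by (simp flip: ennreal_mult')
  also have "\<dots> = ennreal (exp (\<mu> + \<sigma>\<^sup>2 / 2)) * (\<integral>\<^sup>+x. ennreal (normal_density (\<mu> + \<sigma>\<^sup>2) \<sigma> x) \<partial>lborel)"
    by (rule nn_integral_cmult) simp
  also have "(\<integral>\<^sup>+x. ennreal (normal_density (\<mu> + \<sigma>\<^sup>2) \<sigma> x) \<partial>lborel) = 1"
    using assms by (subst nn_integral_eq_integral) (auto simp: integrable_normal_density integral_normal_density)
  finally show ?thesis by simp
qed

context prob_space
begin

lemma normal_rv_moments:
  assumes "normal_rv M X \<mu> \<sigma>"
  shows "integrable M X" "expectation X = \<mu>"
    and "integrable M (\<lambda>x. (X x)\<^sup>2)" "expectation (\<lambda>x. (X x)\<^sup>2) = \<mu>\<^sup>2 + \<sigma>\<^sup>2"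
    and "integrable M (\<lambda>x. exp (X x))" "expectation (\<lambda>x. exp (X x)) = exp (\<mu> + \<sigma>\<^sup>2 / 2)"
proof -
  have X [measurable]: "X \<in> borel_measurable M" and \<sigma>: "0 \<le> \<sigma>" using assms by (simp_all add: normal_rv_def)
  have "integrable M X \<and> expectation X = \<mu> \<and> integrable M (\<lambda>x. (X x)\<^sup>2) \<and>
      expectation (\<lambda>x. (X x)\<^sup>2) = \<mu>\<^sup>2 + \<sigma>\<^sup>2 \<and> integrable M (\<lambda>x. exp (X x)) \<and>
      expectation (\<lambda>x. exp (X x)) = exp (\<mu> + \<sigma>\<^sup>2 / 2)"
  proof (cases "\<sigma> = 0")
    case True
    then have AE: "AE x in M. X x = \<mu>" using assms by (simp add: normal_rv_def)
    have *: "integrable M (\<lambda>x. h (X x)) \<and> expectation (\<lambda>x. h (X x)) = h \<mu>"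
      if [measurable]: "h \<in> borel_measurable borel" for h :: "real \<Rightarrow> real"
    proof
      have "AE x in M. h (X x) = h \<mu>" using AE by eventually_elim simp
      then show "integrable M (\<lambda>x. h (X x))" "expectation (\<lambda>x. h (X x)) = h \<mu>"
        using integrable_cong_AE[of "\<lambda>x. h (X x)" M "\<lambda>_. h \<mu>"] integral_cong_AE[of "\<lambda>x. h (X x)" M "\<lambda>_. h \<mu>"]
        by (simp_all add: prob_space)
    qed
    show ?thesis using *[of "\<lambda>x. x"] *[of "\<lambda>x. x\<^sup>2"] *[of exp] True by simp
  next
    case False
    with \<sigma> have \<sigma>: "0 < \<sigma>" by simp
    with assms have D: "distributed M lborel X (\<lambda>x. ennreal (normal_density \<mu> \<sigma> x))"
      by (simp add: normal_rv_def)
    have first: "integrable M X" "expectation X = \<mu>"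
      using distributed_integrable_var[OF D] integrable_normal_moment_nz_1[OF \<sigma>] normal_distributed_expectation[OF \<sigma> D]
      by simp_all
    have centred: "integrable M (\<lambda>x. (X x - \<mu>)\<^sup>2)" "expectation (\<lambda>x. (X x - \<mu>)\<^sup>2) = \<sigma>\<^sup>2"
      using distributed_integrable[OF D, of "\<lambda>x. (x - \<mu>)\<^sup>2"] integrable_normal_moment[OF \<sigma>, of \<mu> 2]
        normal_distributed_variance[OF \<sigma> D] first
      by simp_all
    have sq: "(X x)\<^sup>2 = (X x - \<mu>)\<^sup>2 + 2 * \<mu> * X x - \<mu>\<^sup>2" for x
      by (simp add: power2_eq_square algebra_simps)
    have second: "integrable M (\<lambda>x. (X x)\<^sup>2)" "expectation (\<lambda>x. (X x)\<^sup>2) = \<mu>\<^sup>2 + \<sigma>\<^sup>2"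
      using first centred unfolding sq by (simp_all add: prob_space power2_eq_square)
    have "(\<integral>\<^sup>+x. ennreal (exp (X x)) \<partial>M) = ennreal (exp (\<mu> + \<sigma>\<^sup>2 / 2))"
      using distributed_nn_integral[OF D, of "\<lambda>x. ennreal (exp x)"] nn_integral_exp_normal_density[OF \<sigma>]
      by simp
    then have "has_bochner_integral M (\<lambda>x. exp (X x)) (exp (\<mu> + \<sigma>\<^sup>2 / 2))"
      by (intro has_bochner_integral_nn_integral) auto
    with first second show ?thesis by (simp add: has_bochner_integral_iff)
  qed
  then show "integrable M X" "expectation X = \<mu>"
    "integrable M (\<lambda>x. (X x)\<^sup>2)" "expectation (\<lambda>x. (X x)\<^sup>2) = \<mu>\<^sup>2 + \<sigma>\<^sup>2"
    "integrable M (\<lambda>x. exp (X x))" "expectation (\<lambda>x. exp (X x)) = exp (\<mu> + \<sigma>\<^sup>2 / 2)"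
    by blast+
qed

end

section \<open>Fractional Brownian motion with drift and its exponential tilt\<close>

locale fbm_with_drift = prob_space M for M :: "'w measure" +
  fixes \<alpha> :: real and B :: "real \<Rightarrow> 'w \<Rightarrow> real"
  assumes \<alpha>_pos: "0 < \<alpha>"
    and fbm: "fractional_brownian_motion M (\<alpha> / 2) B"
begin

abbreviation W :: "real \<Rightarrow> 'w \<Rightarrow> real" where "W \<equiv> W_process \<alpha> B"

abbreviation \<gamma> :: "real \<Rightarrow> real" where "\<gamma> t \<equiv> \<bar>t\<bar> powr \<alpha>"

lemma
  shows gaussian: "gaussian_process M B"
    and mean_B: "expectation (B t) = 0"
    and cov_B: "expectation (\<lambda>\<omega>. B s \<omega> * B t \<omega>) = (\<gamma> s + \<gamma> t - \<gamma> (s - t)) / 2"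
    and continuous_B: "\<omega> \<in> space M \<Longrightarrow> continuous_on UNIV (\<lambda>t. B t \<omega>)"
  using fbm by (simp_all add: fractional_brownian_motion_def)

lemma normal_B: "\<exists>\<mu> \<sigma>. normal_rv M (B t) \<mu> \<sigma>"
  using gaussian[unfolded gaussian_process_def, rule_format, of "{t}" "\<lambda>_. 1"] by simp

lemma B_measurable [measurable]: "B t \<in> borel_measurable M"
  using normal_B[of t] by (auto simp: normal_rv_def)

lemma W_measurable [measurable]: "W t \<in> borel_measurable M"
  unfolding W_process_def[abs_def] by measurable

lemma integrable_B: "integrable M (B t)" and integrable_B_mult: "integrable M (\<lambda>\<omega>. B s \<omega> * B t \<omega>)"
proof -
  have sq: "integrable M (\<lambda>\<omega>. (B t \<omega>)\<^sup>2)" for t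
    using normal_B[of t] normal_rv_moments(3) by blast
  show "integrable M (B t)" using normal_B[of t] normal_rv_moments(1) by blast
  show "integrable M (\<lambda>\<omega>. B s \<omega> * B t \<omega>)"
  proof (rule Bochner_Integration.integrable_bound)
    show "integrable M (\<lambda>\<omega>. (B s \<omega>)\<^sup>2 + (B t \<omega>)\<^sup>2)" using sq by simp
    have "\<bar>a * b\<bar> \<le> a\<^sup>2 + b\<^sup>2" for a b :: real
    proof -
      have "2 * (\<bar>a\<bar> * \<bar>b\<bar>) \<le> a\<^sup>2 + b\<^sup>2"
        using sum_squares_bound[of "\<bar>a\<bar>" "\<bar>b\<bar>"] by simp
      moreover have "0 \<le> \<bar>a\<bar> * \<bar>b\<bar>" by simp
      ultimately show ?thesis unfolding abs_mult by linarith
    qed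
    then show "AE \<omega> in M. norm (B s \<omega> * B t \<omega>) \<le> norm ((B s \<omega>)\<^sup>2 + (B t \<omega>)\<^sup>2)"
      by simp
  qed simp
qed

text \<open>A Gaussian process is only known to have normal linear combinations with some parameters; the first two
moments identify them.\<close>

lemma normal_sum_B:
  assumes "finite T"
  obtains \<sigma> where "normal_rv M (\<lambda>\<omega>. \<Sum>t\<in>T. c t * B t \<omega>) 0 \<sigma>"
    and "\<sigma>\<^sup>2 = (\<Sum>s\<in>T. \<Sum>t\<in>T. c s * c t * (\<gamma> s + \<gamma> t - \<gamma> (s - t)) / 2)"
proof -
  from assms gaussian obtain \<mu> \<sigma> where N: "normal_rv M (\<lambda>\<omega>. \<Sum>t\<in>T. c t * B t \<omega>) \<mu> \<sigma>"
    unfolding gaussian_process_def by blast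
  have \<mu>: "\<mu> = 0"
    using normal_rv_moments(2)[OF N] integrable_B by (simp add: mean_B)
  have "\<sigma>\<^sup>2 = expectation (\<lambda>\<omega>. (\<Sum>t\<in>T. c t * B t \<omega>)\<^sup>2)"
    using normal_rv_moments(4)[OF N] \<mu> by simp
  also have "\<dots> = expectation (\<lambda>\<omega>. \<Sum>s\<in>T. \<Sum>t\<in>T. c s * c t * (B s \<omega> * B t \<omega>))"
    by (simp add: power2_eq_square sum_product mult_ac)
  also have "\<dots> = (\<Sum>s\<in>T. \<Sum>t\<in>T. c s * c t * (\<gamma> s + \<gamma> t - \<gamma> (s - t)) / 2)"
    using integrable_B_mult by (simp add: cov_B)
  finally show ?thesis using that N \<mu> by simp
qed

lemma exp_moment_B:
  assumes "finite T"
  shows "integrable M (\<lambda>\<omega>. exp (\<Sum>t\<in>T. c t * B t \<omega>))"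
    and "expectation (\<lambda>\<omega>. exp (\<Sum>t\<in>T. c t * B t \<omega>))
      = exp ((\<Sum>s\<in>T. \<Sum>t\<in>T. c s * c t * (\<gamma> s + \<gamma> t - \<gamma> (s - t)) / 2) / 2)"
proof -
  from assms obtain \<sigma> where N: "normal_rv M (\<lambda>\<omega>. \<Sum>t\<in>T. c t * B t \<omega>) 0 \<sigma>"
    and \<sigma>: "\<sigma>\<^sup>2 = (\<Sum>s\<in>T. \<Sum>t\<in>T. c s * c t * (\<gamma> s + \<gamma> t - \<gamma> (s - t)) / 2)"
    by (rule normal_sum_B)
  show "integrable M (\<lambda>\<omega>. exp (\<Sum>t\<in>T. c t * B t \<omega>))"
    by (rule normal_rv_moments(5)[OF N])
  show "expectation (\<lambda>\<omega>. exp (\<Sum>t\<in>T. c t * B t \<omega>))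
      = exp ((\<Sum>s\<in>T. \<Sum>t\<in>T. c s * c t * (\<gamma> s + \<gamma> t - \<gamma> (s - t)) / 2) / 2)"
    using normal_rv_moments(6)[OF N] \<sigma> by simp
qed

lemma exp_sum_W:
  "exp (\<Sum>t\<in>T. d t * W t \<omega>) = exp (- (\<Sum>t\<in>T. d t * \<gamma> t)) * exp (\<Sum>t\<in>T. (sqrt 2 * d t) * B t \<omega>)"
  by (simp add: W_process_def exp_add[symmetric] sum_subtractf[symmetric] algebra_simps)

lemma integrable_exp_sum_W: "finite T \<Longrightarrow> integrable M (\<lambda>\<omega>. exp (\<Sum>t\<in>T. d t * W t \<omega>))"
  unfolding exp_sum_W by (intro integrable_mult_right exp_moment_B)

text \<open>The drift \<open>- |t|^\<alpha>\<close> is chosen such that, for coefficients with sum \<open>1\<close>, the terms \<open>|s|^\<alpha>\<close> and \<open>|t|^\<alpha>\<close> of the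
covariance cancel against it. What remains depends only on the differences \<open>s - t\<close>.\<close>

lemma exp_moment_W:
  assumes T: "finite T" and "sum d T = 1"
  shows "expectation (\<lambda>\<omega>. exp (\<Sum>t\<in>T. d t * W t \<omega>))
      = exp (- (\<Sum>s\<in>T. \<Sum>t\<in>T. d s * d t * \<gamma> (s - t)) / 2)"
proof -
  let ?Q = "\<Sum>s\<in>T. \<Sum>t\<in>T. d s * d t * \<gamma> (s - t)" and ?L = "\<Sum>t\<in>T. d t * \<gamma> t"
  have "(\<Sum>s\<in>T. \<Sum>t\<in>T. (sqrt 2 * d s) * (sqrt 2 * d t) * (\<gamma> s + \<gamma> t - \<gamma> (s - t)) / 2)
      = (\<Sum>s\<in>T. \<Sum>t\<in>T. (d s * \<gamma> s) * d t + d s * (d t * \<gamma> t) - d s * d t * \<gamma> (s - t))"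
    by (intro sum.cong refl) (simp add: field_simps)
  also have "\<dots> = ?L * sum d T + sum d T * ?L - ?Q"
    by (simp add: sum_subtractf sum.distrib sum_product)
  finally have "(\<Sum>s\<in>T. \<Sum>t\<in>T. (sqrt 2 * d s) * (sqrt 2 * d t) * (\<gamma> s + \<gamma> t - \<gamma> (s - t)) / 2)
      = 2 * ?L - ?Q"
    using assms(2) by simp
  then have "expectation (\<lambda>\<omega>. exp (\<Sum>t\<in>T. d t * W t \<omega>)) = exp (- ?L) * exp ((2 * ?L - ?Q) / 2)"
    using exp_moment_B(2)[OF T, of "\<lambda>t. sqrt 2 * d t"] unfolding exp_sum_W by simp
  then show ?thesis
    by (simp add: exp_add[symmetric] diff_divide_distrib)
qed

lemma exp_moment_W_shift:
  assumes T: "finite T" and "sum d T = 1"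
  shows "expectation (\<lambda>\<omega>. exp (\<Sum>t\<in>T. d t * W (t - s) \<omega>))
       = expectation (\<lambda>\<omega>. exp (\<Sum>t\<in>T. d t * W t \<omega>))"
proof -
  have inj: "inj_on (\<lambda>t. t - s) T" by (simp add: inj_on_def)
  let ?T = "(\<lambda>t. t - s) ` T" and ?d = "\<lambda>t. d (t + s)"
  have "expectation (\<lambda>\<omega>. exp (\<Sum>t\<in>?T. ?d t * W t \<omega>))
      = exp (- (\<Sum>u\<in>?T. \<Sum>t\<in>?T. ?d u * ?d t * \<gamma> (u - t)) / 2)"
    using assms inj by (intro exp_moment_W) (auto simp: sum.reindex)
  then show ?thesis
    using inj by (simp add: exp_moment_W[OF assms] sum.reindex)
qed

lemma AE_B_0: "AE \<omega> in M. B 0 \<omega> = 0"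
proof -
  have "expectation (\<lambda>\<omega>. B 0 \<omega> * B 0 \<omega>) = 0" using cov_B[of 0 0] by simp
  then have "AE \<omega> in M. B 0 \<omega> * B 0 \<omega> = 0"
    using integrable_B_mult[of 0 0] by (subst (asm) integral_nonneg_eq_0_iff_AE) auto
  then show ?thesis by simp
qed

lemma AE_W_0: "AE \<omega> in M. W 0 \<omega> = 0"
  using AE_B_0 by eventually_elim (simp add: W_process_def)

text \<open>The exponential moments of \<open>W - W s\<close> under the weight \<open>exp (W s)\<close> are exponential moments of \<open>W\<close> with
coefficients of sum \<open>1\<close>, hence invariant under a shift of time; after the shift the coefficient at time \<open>s\<close> sits
at time \<open>0\<close>, where \<open>W\<close> vanishes almost surely.\<close>

lemma tilted_law:
  "distr (density M (\<lambda>\<omega>. ennreal (exp (W s \<omega>)))) (\<Pi>\<^sub>M t\<in>UNIV. borel) (\<lambda>\<omega> t. W t \<omega> - W s \<omega>)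
    = distr M (\<Pi>\<^sub>M t\<in>UNIV. borel) (\<lambda>\<omega> t. W (t - s) \<omega>)"
proof (rule process_law_eqI_mgf)
  let ?D = "density M (\<lambda>\<omega>. ennreal (exp (W s \<omega>)))"
  have key: "integrable M (\<lambda>\<omega>. exp (W s \<omega>) * exp (\<Sum>t\<in>T. c t * (W t \<omega> - W s \<omega>)))"
    "expectation (\<lambda>\<omega>. exp (W s \<omega>) * exp (\<Sum>t\<in>T. c t * (W t \<omega> - W s \<omega>)))
      = expectation (\<lambda>\<omega>. exp (\<Sum>t\<in>T. c t * W (t - s) \<omega>))"
    if T: "finite T" for T c
  proof -
    \<comment> \<open>The coefficient of \<open>W s\<close> collects the weight \<open>exp (W s)\<close> and the subtracted terms \<open>c t * W s\<close>, which makes the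
      total \<open>1\<close>. The time \<open>s\<close> may or may not belong to \<open>T\<close>.\<close>
    define d where "d t = (if t \<in> T then c t else 0) + (if t = s then 1 - sum c T else 0)" for t
    have sum_d: "(\<Sum>t\<in>insert s T. d t * Z t) = (\<Sum>t\<in>T. c t * Z t) + (1 - sum c T) * Z s" for Z :: "real \<Rightarrow> real"
    proof -
      have "(\<Sum>t\<in>insert s T. (if t \<in> T then c t else 0) * Z t) = (\<Sum>t\<in>T. c t * Z t)"
        using T by (intro sum.mono_neutral_cong_right) auto
      moreover have "(\<Sum>t\<in>insert s T. (if t = s then 1 - sum c T else 0) * Z t) = (1 - sum c T) * Z s"
        using T by (subst sum.cong[OF refl, of _ _ "\<lambda>t. if t = s then (1 - sum c T) * Z s else 0"]) auto
      ultimately show ?thesis by (simp add: d_def sum.distrib distrib_right)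
    qed
    have T': "finite (insert s T)" "sum d (insert s T) = 1"
      using T sum_d[of "\<lambda>_. 1"] by simp_all
    have lhs: "exp (W s \<omega>) * exp (\<Sum>t\<in>T. c t * (W t \<omega> - W s \<omega>)) = exp (\<Sum>t\<in>insert s T. d t * W t \<omega>)" for \<omega>
      unfolding sum_d by (simp add: exp_add[symmetric] algebra_simps sum_subtractf sum_distrib_left sum_distrib_right)
    show "integrable M (\<lambda>\<omega>. exp (W s \<omega>) * exp (\<Sum>t\<in>T. c t * (W t \<omega> - W s \<omega>)))"
      unfolding lhs by (rule integrable_exp_sum_W[OF T'(1)])
    \<comment> \<open>At \<open>t = s\<close> the added term is a multiple of \<open>W 0\<close>, which is almost surely \<open>0\<close>.\<close>
    have "expectation (\<lambda>\<omega>. exp (\<Sum>t\<in>T. c t * W (t - s) \<omega>))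
        = expectation (\<lambda>\<omega>. exp (\<Sum>t\<in>insert s T. d t * W (t - s) \<omega>))"
    proof (rule integral_cong_AE)
      show "AE \<omega> in M. exp (\<Sum>t\<in>T. c t * W (t - s) \<omega>) = exp (\<Sum>t\<in>insert s T. d t * W (t - s) \<omega>)"
        using AE_W_0 by eventually_elim (simp only: sum_d, simp)
    qed measurable
    then show "expectation (\<lambda>\<omega>. exp (W s \<omega>) * exp (\<Sum>t\<in>T. c t * (W t \<omega> - W s \<omega>)))
        = expectation (\<lambda>\<omega>. exp (\<Sum>t\<in>T. c t * W (t - s) \<omega>))"
      unfolding lhs by (simp only: exp_moment_W_shift[OF T'])
  qed
  have "emeasure ?D (space M) = (\<integral>\<^sup>+\<omega>. ennreal (exp (W s \<omega>)) \<partial>M)"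
    by (subst emeasure_density) (auto intro!: nn_integral_cong)
  also have "\<dots> = 1"
    using key[of "{}"] by (subst nn_integral_eq_integral) (auto simp: prob_space)
  finally show "prob_space ?D" by (intro prob_spaceI) simp
  show "integrable M (\<lambda>\<omega>. exp (\<Sum>t\<in>T. c t * W (t - s) \<omega>))" if T: "finite T" for T c
  proof -
    have "inj_on (\<lambda>t. t - s) T" by (simp add: inj_on_def)
    then show ?thesis
      using integrable_exp_sum_W[of "(\<lambda>t. t - s) ` T" "\<lambda>t. c (t + s)"] T by (simp add: sum.reindex)
  qed
  show "integrable ?D (\<lambda>\<omega>. exp (\<Sum>t\<in>T. c t * (W t \<omega> - W s \<omega>)))" if T: "finite T" for T c
    using key(1)[OF T] by (subst integrable_density) auto
  show "integral\<^sup>L ?D (\<lambda>\<omega>. exp (\<Sum>t\<in>T. c t * (W t \<omega> - W s \<omega>)))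
      = expectation (\<lambda>\<omega>. exp (\<Sum>t\<in>T. c t * W (t - s) \<omega>))" if T: "finite T" for T c
    using key(2)[OF T] by (subst integral_density) auto
qed (use prob_space_axioms in auto)

lemma nn_integral_tilt:
  assumes [measurable]: "F \<in> borel_measurable (\<Pi>\<^sub>M t\<in>UNIV. borel)"
  shows "(\<integral>\<^sup>+\<omega>. ennreal (exp (W s \<omega>)) * F (\<lambda>t. W t \<omega> - W s \<omega>) \<partial>M) = (\<integral>\<^sup>+\<omega>. F (\<lambda>t. W (t - s) \<omega>) \<partial>M)"
proof -
  have [measurable]: "(\<lambda>\<omega> t. W t \<omega> - W s \<omega>) \<in> measurable M (\<Pi>\<^sub>M t\<in>UNIV. borel)"
    "(\<lambda>\<omega> t. W (t - s) \<omega>) \<in> measurable M (\<Pi>\<^sub>M t\<in>UNIV. borel)"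
    by (auto intro!: measurable_PiM_single')
  have "(\<integral>\<^sup>+\<omega>. ennreal (exp (W s \<omega>)) * F (\<lambda>t. W t \<omega> - W s \<omega>) \<partial>M)
      = (\<integral>\<^sup>+f. F f \<partial>distr (density M (\<lambda>\<omega>. ennreal (exp (W s \<omega>)))) (\<Pi>\<^sub>M t\<in>UNIV. borel) (\<lambda>\<omega> t. W t \<omega> - W s \<omega>))"
    by (simp add: nn_integral_distr nn_integral_density)
  also have "\<dots> = (\<integral>\<^sup>+\<omega>. F (\<lambda>t. W (t - s) \<omega>) \<partial>M)"
    unfolding tilted_law by (simp add: nn_integral_distr)
  finally show ?thesis .
qed

lemma continuous_W: "\<omega> \<in> space M \<Longrightarrow> continuous_on UNIV (\<lambda>t. W t \<omega>)"
  unfolding W_process_def using \<alpha>_pos continuous_B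
  by (auto intro!: continuous_intros continuous_on_powr')

end

section \<open>Occupation times of continuous paths\<close>

text \<open>The sojourn time of a path above a level is not a function of finitely many coordinates, and evaluation
\<open>(f, s) \<mapsto> f s\<close> is not jointly measurable on the full product space. Reading a path off along finer and finer grids
gives a jointly measurable map that agrees with evaluation on continuous paths.\<close>

definition grid_limit :: "(real \<Rightarrow> real) \<Rightarrow> real \<Rightarrow> real" where
  "grid_limit f s = lim (\<lambda>n. f (of_int \<lfloor>real n * s\<rfloor> / real n))"

lemma grid_limit_continuous:
  assumes "continuous_on UNIV f"
  shows "grid_limit f s = f s"
proof -
  have "(\<lambda>n. of_int \<lfloor>real n * s\<rfloor> / real n) \<longlonglongrightarrow> s"
  proof (rule real_tendsto_sandwich)
    show "\<forall>\<^sub>F n in sequentially. s - 1 / real n \<le> of_int \<lfloor>real n * s\<rfloor> / real n"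
      using eventually_gt_at_top[of 0]
    proof eventually_elim
      case (elim n)
      have "s - 1 / real n = (real n * s - 1) / real n" using elim by (simp add: field_simps)
      also have "\<dots> \<le> of_int \<lfloor>real n * s\<rfloor> / real n"
        by (intro divide_right_mono) linarith+
      finally show ?case .
    qed
    show "\<forall>\<^sub>F n in sequentially. of_int \<lfloor>real n * s\<rfloor> / real n \<le> s"
      using eventually_gt_at_top[of 0]
    proof eventually_elim
      case (elim n)
      have "of_int \<lfloor>real n * s\<rfloor> / real n \<le> (real n * s) / real n"
        by (intro divide_right_mono) auto
      with elim show ?case by simp
    qed
    show "(\<lambda>n. s - 1 / real n) \<longlonglongrightarrow> s"
      by (rule tendsto_eq_intros lim_1_over_n | simp)+
  qed simp
  then have "(\<lambda>n. f (of_int \<lfloor>real n * s\<rfloor> / real n)) \<longlonglongrightarrow> f s"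
    using assms by (intro isCont_tendsto_compose[of s f]) (auto simp: continuous_on_eq_continuous_at)
  then show ?thesis unfolding grid_limit_def by (rule limI)
qed

lemma grid_limit_measurable [measurable (raw)]:
  assumes [measurable]: "f \<in> measurable N (\<Pi>\<^sub>M t\<in>UNIV. borel)" "g \<in> borel_measurable N"
  shows "(\<lambda>x. grid_limit (f x) (g x)) \<in> borel_measurable N"
proof -
  have "(\<lambda>x. f x (of_int \<lfloor>real n * g x\<rfloor> / real n)) \<in> borel_measurable N" for n
    by (rule measurable_compose_countable[where f = "\<lambda>i x. f x (of_int i / real n)"]) measurable
  then show ?thesis unfolding grid_limit_def by measurable
qed

definition occupation :: "real set \<Rightarrow> (real \<Rightarrow> real) \<Rightarrow> ennreal" where
  "occupation A f = (\<integral>\<^sup>+s\<in>A. indicator {0<..} (f s) \<partial>lborel)"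

lemma occupation_measurable [measurable (raw)]:
  assumes [measurable]: "case_prod f \<in> borel_measurable (N \<Otimes>\<^sub>M borel)" "A \<in> sets borel"
  shows "(\<lambda>x. occupation A (f x)) \<in> borel_measurable N"
  unfolding occupation_def by measurable

lemma occupation_mono: "A \<subseteq> A' \<Longrightarrow> occupation A f \<le> occupation A' f"
  unfolding occupation_def by (intro nn_integral_mono) (auto simp: indicator_def)

lemma occupation_shift:
  assumes [measurable]: "f \<in> borel_measurable borel"
  shows "occupation {a..b} (\<lambda>u. f (u - s)) = occupation {a - s..b - s} f"
proof -
  have "occupation {a..b} (\<lambda>u. f (u - s))
      = (\<integral>\<^sup>+u. indicator {0<..} (f (s + 1 * u - s)) * indicator {a..b} (s + 1 * u) \<partial>lborel)"
    unfolding occupation_def by (subst nn_integral_real_affine[where t = s and c = 1]) auto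
  also have "\<dots> = occupation {a - s..b - s} f"
    unfolding occupation_def by (intro nn_integral_cong) (auto simp: indicator_def)
  finally show ?thesis .
qed

lemma occupation_pos:
  assumes cont: "continuous_on UNIV f" and "a < b" and t: "t \<in> {a..b}" "0 < f t"
  shows "0 < occupation {a..b} f"
proof -
  have "isCont f t" using cont by (simp add: continuous_on_eq_continuous_at)
  then obtain d where d: "0 < d" "\<And>u. \<bar>u - t\<bar> < d \<Longrightarrow> 0 < f u"
    using t(2) unfolding continuous_at_eps_delta
    by (metis (no_types, opaque_lifting) abs_diff_less_iff diff_gt_0_iff_gt dist_real_def diff_self)
  define l r where "l = max a (t - d / 2)" and "r = min b (t + d / 2)"
  have lr: "l < r" "{l..r} \<subseteq> {a..b}" "\<And>u. u \<in> {l..r} \<Longrightarrow> 0 < f u"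
    using d t \<open>a < b\<close> by (auto simp: l_def r_def intro!: d(2))
  have "0 < ennreal (r - l)" using lr by simp
  also have "ennreal (r - l) = (\<integral>\<^sup>+u. indicator {l..r} u \<partial>lborel)" using lr by simp
  also have "\<dots> \<le> occupation {a..b} f"
    unfolding occupation_def using lr by (intro nn_integral_mono) (auto simp: indicator_def)
  finally show ?thesis .
qed

lemma occupation_le: "a \<le> b \<Longrightarrow> occupation {a..b} f \<le> ennreal (b - a)"
proof -
  assume "a \<le> b"
  have "occupation {a..b} f \<le> (\<integral>\<^sup>+u. indicator {a..b} u \<partial>lborel)"
    unfolding occupation_def by (intro nn_integral_mono) (auto simp: indicator_def)
  also have "\<dots> = ennreal (b - a)" using \<open>a \<le> b\<close> by simp
  finally show ?thesis .
qed

lemma nn_integral_exp_tail: "(\<integral>\<^sup>+y\<in>{a<..}. ennreal (exp (- y)) \<partial>lborel) = ennreal (exp (- a))"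
proof -
  have "(\<integral>\<^sup>+y\<in>{a<..}. ennreal (exp (- y)) \<partial>lborel) = (\<integral>\<^sup>+y. ennreal (exp (- y)) * indicator {a..} y \<partial>lborel)"
    by (intro nn_integral_cong_AE, rule AE_mp[OF AE_lborel_singleton[of a]])
      (auto simp: indicator_def)
  also have "\<dots> = ennreal (0 - (- exp (- a)))"
  proof (rule nn_integral_FTC_atLeast)
    show "((\<lambda>y::real. - exp (- y)) \<longlongrightarrow> 0) at_top"
    proof -
      have "((\<lambda>y::real. exp (- y)) \<longlongrightarrow> 0) at_top"
        by (rule filterlim_compose[OF exp_at_bot filterlim_uminus_at_bot_at_top])
      from tendsto_minus[OF this] show ?thesis by simp
    qed
  qed (auto intro!: derivative_eq_intros)
  finally show ?thesis by simp
qed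

lemma exp_sup_attained:
  fixes w :: "real \<Rightarrow> real"
  assumes "continuous_on UNIV w" "0 < S"
  obtains t0 where "t0 \<in> {0..S}" "\<And>t. t \<in> {0..S} \<Longrightarrow> w t \<le> w t0"
    and "(SUP t\<in>{0..S}. exp (w t)) = exp (w t0)"
proof -
  obtain t0 where t0: "t0 \<in> {0..S}" "\<And>t. t \<in> {0..S} \<Longrightarrow> w t \<le> w t0"
    using continuous_attains_sup[OF compact_Icc[of 0 S], of w]
      continuous_on_subset[OF assms(1) subset_UNIV] assms(2) by auto
  moreover from t0 have "(SUP t\<in>{0..S}. exp (w t)) = exp (w t0)"
    by (intro cSup_eq_maximum) auto
  ultimately show ?thesis by (rule that)
qed

lemma exp_sup_nonneg:
  fixes w :: "real \<Rightarrow> real"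
  assumes "continuous_on UNIV w" "0 < S"
  shows "0 \<le> (SUP t\<in>{0..S}. exp (w t))"
  using exp_sup_attained[OF assms] by (metis exp_ge_zero)

text \<open>The layer-cake formula for \<open>exp (sup w)\<close> in the level \<open>- y\<close>, with the value \<open>1\<close> of the indicator that some \<open>w s + y\<close>
is positive written as sojourn time times its reciprocal. Continuity makes the sojourn time positive whenever the
level is exceeded at all; otherwise the integrand vanishes, since \<open>0 \<cdot> \<infinity> = 0\<close>.\<close>

lemma exp_sup_eq_nn_integral:
  fixes w :: "real \<Rightarrow> real"
  assumes cont: "continuous_on UNIV w" and S: "0 < S"
  shows "ennreal (SUP t\<in>{0..S}. exp (w t))
    = (\<integral>\<^sup>+y. (\<integral>\<^sup>+s\<in>{0..S}. (ennreal (exp (- y)) * (indicator {0<..} (w s + y) *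
         inverse (occupation {0..S} (\<lambda>u. w u + y)))) \<partial>lborel) \<partial>lborel)"
proof -
  have [measurable]: "w \<in> borel_measurable borel" using cont by (rule borel_measurable_continuous_onI)
  obtain t0 where t0: "t0 \<in> {0..S}" "\<And>t. t \<in> {0..S} \<Longrightarrow> w t \<le> w t0"
    and sup: "(SUP t\<in>{0..S}. exp (w t)) = exp (w t0)"
    using exp_sup_attained[OF cont S] by blast
  have inner: "(\<integral>\<^sup>+s\<in>{0..S}. (ennreal (exp (- y)) * (indicator {0<..} (w s + y) *
         inverse (occupation {0..S} (\<lambda>u. w u + y)))) \<partial>lborel) = ennreal (exp (- y)) * indicator {- w t0<..} y" for y
  proof -
    let ?L = "occupation {0..S} (\<lambda>u. w u + y)"
    have "(\<integral>\<^sup>+s\<in>{0..S}. (ennreal (exp (- y)) * (indicator {0<..} (w s + y) * inverse ?L)) \<partial>lborel)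
        = (\<integral>\<^sup>+s. (ennreal (exp (- y)) * inverse ?L) * (indicator {0<..} (w s + y) * indicator {0..S} s) \<partial>lborel)"
      by (intro nn_integral_cong) (simp add: mult_ac)
    also have "\<dots> = ennreal (exp (- y)) * (inverse ?L * ?L)"
      unfolding occupation_def by (subst nn_integral_cmult) (simp_all add: mult_ac)
    also have "inverse ?L * ?L = indicator {- w t0<..} y"
    proof (cases "- w t0 < y")
      case True
      have "0 < ?L"
        using t0(1) True S by (intro occupation_pos continuous_intros cont) auto
      moreover have "?L < \<top>"
        using occupation_le[of 0 S "\<lambda>u. w u + y"] S by (auto intro: le_less_trans)
      ultimately have "?L / ?L = 1" by (intro ennreal_divide_self) auto
      then show ?thesis using True by (simp add: divide_ennreal_def mult.commute)
    next
      case False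
      then have "\<And>s. s \<in> {0..S} \<Longrightarrow> w s + y \<le> 0" using t0(2) by fastforce
      then have "?L = (\<integral>\<^sup>+s. 0 \<partial>(lborel :: real measure))"
        unfolding occupation_def by (intro nn_integral_cong) (auto simp: indicator_def not_less[symmetric])
      then have "?L = 0" by simp
      then show ?thesis using False by simp
    qed
    finally show ?thesis .
  qed
  show ?thesis
    unfolding inner sup nn_integral_exp_tail by simp
qed

section \<open>The exponential supremum as an integral of reciprocal sojourn times\<close>

context fbm_with_drift
begin

lemma W_path_measurable [measurable]: "(\<lambda>\<omega> t. W (t - s) \<omega>) \<in> measurable M (\<Pi>\<^sub>M t\<in>UNIV. borel)"
  by (rule measurable_PiM_single') auto

text \<open>Joint measurability in time and in the sample point, without which neither sojourn times nor Fubini make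
sense, comes from continuity of the paths through \<open>grid_limit\<close>.\<close>

lemma W_jointly_measurable [measurable (raw)]:
  assumes [measurable]: "f \<in> measurable N M" "g \<in> borel_measurable N"
  shows "(\<lambda>x. W (g x) (f x)) \<in> borel_measurable N"
proof -
  have [measurable]: "(\<lambda>\<omega> t. W t \<omega>) \<in> measurable M (\<Pi>\<^sub>M t\<in>UNIV. borel)"
    using W_path_measurable[of 0] by simp
  have "(\<lambda>x. grid_limit (\<lambda>t. W t (f x)) (g x)) \<in> borel_measurable N"
    by (rule grid_limit_measurable) (auto intro: measurable_compose[OF assms(1)])
  also have "?this \<longleftrightarrow> ?thesis"
    using measurable_space[OF assms(1)]
    by (intro measurable_cong) (auto simp: grid_limit_continuous[OF continuous_W])
  finally show ?thesis .
qed

text \<open>The expected reciprocal of the time in \<open>A\<close> at which \<open>W\<close> exceeds an independent level \<open>- Z\<close>, with \<open>Z\<close> exponential of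
mean \<open>1\<close>. The level is integrated out explicitly, so that the quantity depends on the law of \<open>W\<close> only.\<close>

definition inverse_sojourn :: "real set \<Rightarrow> ennreal" where
  "inverse_sojourn A = (\<integral>\<^sup>+z. ennreal (exponential_density 1 z) *
     (\<integral>\<^sup>+\<omega>. inverse (occupation A (\<lambda>s. W s \<omega> + z)) \<partial>M) \<partial>lborel)"

lemma tilted_occupation:
  "(\<integral>\<^sup>+\<omega>. ennreal (exp (W s \<omega>)) * inverse (occupation {a..b} (\<lambda>u. W u \<omega> - W s \<omega> + z)) \<partial>M)
    = (\<integral>\<^sup>+\<omega>. inverse (occupation {a - s..b - s} (\<lambda>u. W u \<omega> + z)) \<partial>M)"
proof -
  define F where "F f = inverse (occupation {a..b} (\<lambda>u. grid_limit f u + z))" for f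
  have F: "F \<in> borel_measurable (\<Pi>\<^sub>M t\<in>UNIV. borel)"
    unfolding F_def[abs_def] by measurable
  have "(\<integral>\<^sup>+\<omega>. ennreal (exp (W s \<omega>)) * inverse (occupation {a..b} (\<lambda>u. W u \<omega> - W s \<omega> + z)) \<partial>M)
      = (\<integral>\<^sup>+\<omega>. ennreal (exp (W s \<omega>)) * F (\<lambda>u. W u \<omega> - W s \<omega>) \<partial>M)"
    unfolding F_def
    by (intro nn_integral_cong) (simp add: grid_limit_continuous continuous_W continuous_on_diff)
  also have "\<dots> = (\<integral>\<^sup>+\<omega>. F (\<lambda>u. W (u - s) \<omega>) \<partial>M)" by (rule nn_integral_tilt[OF F])
  also have "\<dots> = (\<integral>\<^sup>+\<omega>. inverse (occupation {a - s..b - s} (\<lambda>u. W u \<omega> + z)) \<partial>M)"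
  proof (rule nn_integral_cong)
    fix \<omega> assume \<omega>: "\<omega> \<in> space M"
    have cont: "continuous_on UNIV (\<lambda>u. W (u - s) \<omega>)"
      by (intro continuous_on_compose2[OF continuous_W[OF \<omega>]] continuous_intros) auto
    have "(\<lambda>u. W u \<omega> + z) \<in> borel_measurable borel"
      by (intro borel_measurable_continuous_onI continuous_intros continuous_W \<omega>)
    from occupation_shift[OF this]
    show "F (\<lambda>u. W (u - s) \<omega>) = inverse (occupation {a - s..b - s} (\<lambda>u. W u \<omega> + z))"
      unfolding F_def by (simp add: grid_limit_continuous[OF cont])
  qed
  finally show ?thesis .
qed

lemma nn_integral_swap_M:
  assumes "case_prod f \<in> borel_measurable (M \<Otimes>\<^sub>M lborel)"
  shows "(\<integral>\<^sup>+\<omega>. (\<integral>\<^sup>+s. f \<omega> s \<partial>lborel) \<partial>M) = (\<integral>\<^sup>+s. (\<integral>\<^sup>+\<omega>. f \<omega> s \<partial>M) \<partial>lborel)"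
proof -
  interpret pair_sigma_finite M lborel by standard
  show ?thesis using Fubini'[OF assms] by simp
qed

text \<open>Start from the pathwise formula \<open>exp_sup_eq_nn_integral\<close> and fix the time \<open>s\<close> of the inner integral. The substitution
\<open>y = z - W s\<close> turns the weight \<open>exp (- y)\<close> into \<open>exp (- z) exp (W s)\<close> and restricts \<open>z\<close> to the positive axis; the factor
\<open>exp (W s)\<close> is then absorbed by tilting, which recentres the window \<open>[0, S]\<close> at \<open>s\<close>.\<close>

lemma nn_integral_exp_sup:
  assumes "0 < S"
  shows "(\<integral>\<^sup>+\<omega>. ennreal (SUP t\<in>{0..S}. exp (W t \<omega>)) \<partial>M) = (\<integral>\<^sup>+s\<in>{0..S}. inverse_sojourn {- s..S - s} \<partial>lborel)"
proof -
  define f where "f \<omega> s y = ennreal (exp (- y)) * (indicator {0<..} (W s \<omega> + y) *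
      inverse (occupation {0..S} (\<lambda>u. W u \<omega> + y)))" for \<omega> s y
  have f_meas [measurable (raw)]: "(\<lambda>x. f (g x) (h x) (k x)) \<in> borel_measurable N"
    if [measurable]: "g \<in> measurable N M" "h \<in> borel_measurable N" "k \<in> borel_measurable N"
    for N :: "'z measure" and g h k
    unfolding f_def by measurable
  have "(\<integral>\<^sup>+\<omega>. ennreal (SUP t\<in>{0..S}. exp (W t \<omega>)) \<partial>M)
      = (\<integral>\<^sup>+\<omega>. (\<integral>\<^sup>+y. (\<integral>\<^sup>+s. f \<omega> s y * indicator {0..S} s \<partial>lborel) \<partial>lborel) \<partial>M)"
    unfolding f_def by (intro nn_integral_cong exp_sup_eq_nn_integral continuous_W assms)
  also have "\<dots> = (\<integral>\<^sup>+\<omega>. (\<integral>\<^sup>+s. (\<integral>\<^sup>+y. f \<omega> s y * indicator {0..S} s \<partial>lborel) \<partial>lborel) \<partial>M)"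
    by (intro nn_integral_cong lborel_pair.Fubini') measurable
  also have "\<dots> = (\<integral>\<^sup>+s. (\<integral>\<^sup>+\<omega>. (\<integral>\<^sup>+y. f \<omega> s y * indicator {0..S} s \<partial>lborel) \<partial>M) \<partial>lborel)"
    by (intro nn_integral_swap_M) measurable
  also have "\<dots> = (\<integral>\<^sup>+s\<in>{0..S}. (\<integral>\<^sup>+\<omega>. (\<integral>\<^sup>+y. f \<omega> s y \<partial>lborel) \<partial>M) \<partial>lborel)"
    by (intro nn_integral_cong) (auto simp: indicator_def)
  also have "\<dots> = (\<integral>\<^sup>+s\<in>{0..S}. inverse_sojourn {- s..S - s} \<partial>lborel)"
  proof -
    have "(\<integral>\<^sup>+\<omega>. (\<integral>\<^sup>+y. f \<omega> s y \<partial>lborel) \<partial>M) = inverse_sojourn {- s..S - s}" for s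
    proof -
      let ?I = "\<lambda>z \<omega>. ennreal (exp (W s \<omega>)) * inverse (occupation {0..S} (\<lambda>u. W u \<omega> - W s \<omega> + z))"
      have "(\<integral>\<^sup>+y. f \<omega> s y \<partial>lborel) = (\<integral>\<^sup>+z. ennreal (exponential_density 1 z) * ?I z \<omega> \<partial>lborel)"
        if [measurable]: "\<omega> \<in> space M" for \<omega>
      proof -
        have [measurable]: "f \<omega> s \<in> borel_measurable borel"
          by measurable
        have "(\<integral>\<^sup>+y. f \<omega> s y \<partial>lborel) = (\<integral>\<^sup>+z. f \<omega> s (- W s \<omega> + 1 * z) \<partial>lborel)"
          by (subst nn_integral_real_affine[where t = "- W s \<omega>" and c = 1]) auto
        also have "\<dots> = (\<integral>\<^sup>+z. ennreal (exponential_density 1 z) * ?I z \<omega> \<partial>lborel)"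
          \<comment> \<open>At \<open>z = 0\<close> the exponential density is \<open>1\<close>, whereas the sojourn indicator of the open half-line is \<open>0\<close>.\<close>
        proof (rule nn_integral_cong_AE, rule AE_mp[OF AE_lborel_singleton[of 0]], intro AE_I2 impI)
          fix z :: real assume "z \<noteq> 0"
          have "(\<lambda>u. W u \<omega> + (- W s \<omega> + 1 * z)) = (\<lambda>u. W u \<omega> - W s \<omega> + z)"
            by (simp add: algebra_simps)
          then show "f \<omega> s (- W s \<omega> + 1 * z) = ennreal (exponential_density 1 z) * ?I z \<omega>"
            using \<open>z \<noteq> 0\<close>
            by (auto simp: f_def exponential_density_def exp_diff exp_minus divide_inverse ennreal_mult mult_ac indicator_def)
        qed
        finally show ?thesis .
      qed
      then have "(\<integral>\<^sup>+\<omega>. (\<integral>\<^sup>+y. f \<omega> s y \<partial>lborel) \<partial>M)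
          = (\<integral>\<^sup>+\<omega>. (\<integral>\<^sup>+z. ennreal (exponential_density 1 z) * ?I z \<omega> \<partial>lborel) \<partial>M)"
        by (rule nn_integral_cong)
      also have "\<dots> = (\<integral>\<^sup>+z. (\<integral>\<^sup>+\<omega>. ennreal (exponential_density 1 z) * ?I z \<omega> \<partial>M) \<partial>lborel)"
        by (intro nn_integral_swap_M) measurable
      also have "\<dots> = (\<integral>\<^sup>+z. ennreal (exponential_density 1 z) * (\<integral>\<^sup>+\<omega>. ?I z \<omega> \<partial>M) \<partial>lborel)"
        by (intro nn_integral_cong nn_integral_cmult) measurable
      also have "\<dots> = inverse_sojourn {- s..S - s}"
        unfolding inverse_sojourn_def tilted_occupation by simp
      finally show ?thesis .
    qed
    then show ?thesis by simp
  qed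
  finally show ?thesis .
qed

end

section \<open>Finiteness of the exponential supremum\<close>

text \<open>Each dyadic point of level \<open>n + 1\<close> is one step of that level away from a point of level \<open>n\<close>, so the step bounds
add up to a geometric series.\<close>

lemma dyadic_chaining:
  fixes f :: "real \<Rightarrow> real"
  assumes cont: "continuous_on UNIV f" and T: "0 < T" and q: "0 < q" "q < 1" and Z: "0 \<le> Z"
    and step: "\<And>n k. k < 2 ^ n \<Longrightarrow> \<bar>f (real (Suc k) * T / 2 ^ n) - f (real k * T / 2 ^ n)\<bar> \<le> Z * q ^ n"
    and t: "t \<in> {0..T}"
  shows "\<bar>f t - f 0\<bar> \<le> Z / (1 - q)"
proof -
  have dyadic: "\<bar>f (real j * T / 2 ^ n) - f 0\<bar> \<le> Z * (\<Sum>i\<le>n. q ^ i)" if "j \<le> 2 ^ n" for n j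
    using that
  proof (induction n arbitrary: j)
    case 0
    then have "j = 0 \<or> j = 1" by auto
    then show ?case using step[of 0 0] Z by auto
  next
    case (Suc n)
    define i where "i = j div 2"
    have half: "real (2 * i) * T / 2 ^ Suc n = real i * T / 2 ^ n" by simp
    have i: "i \<le> 2 ^ n" using Suc.prems by (simp add: i_def)
    have IH: "\<bar>f (real (2 * i) * T / 2 ^ Suc n) - f 0\<bar> \<le> Z * (\<Sum>i\<le>n. q ^ i)"
      unfolding half by (rule Suc.IH[OF i])
    have q': "0 \<le> Z * q ^ Suc n" using Z q by simp
    show ?case
    proof (cases "even j")
      case True
      then have "j = 2 * i" by (simp add: i_def)
      with IH q' show ?thesis by (simp add: distrib_left del: of_nat_mult power_Suc)
    next
      case False
      then have j: "j = Suc (2 * i)" by (simp add: i_def)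
      with Suc.prems have "2 * i < 2 ^ Suc n" by simp
      from step[OF this] IH show ?thesis
        unfolding j by (simp add: distrib_left del: of_nat_mult of_nat_Suc power_Suc)
    qed
  qed
  have sum_le: "(\<Sum>i\<le>n. q ^ i) \<le> 1 / (1 - q)" for n
    using sum_le_suminf[OF summable_geometric, of q "{..n}"] q by (simp add: suminf_geometric)
  define u where "u n = real (nat \<lfloor>2 ^ n * (t / T)\<rfloor>) * T / 2 ^ n" for n :: nat
  have bound: "\<bar>f (u n) - f 0\<bar> \<le> Z / (1 - q)" for n
  proof -
    have "t / T \<le> 1" using t T by simp
    then have "2 ^ n * (t / T) \<le> 2 ^ n" by (intro mult_left_le) auto
    then have "nat \<lfloor>2 ^ n * (t / T)\<rfloor> \<le> 2 ^ n"
      by (simp add: nat_le_iff floor_le_iff)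
    from dyadic[OF this] have "\<bar>f (u n) - f 0\<bar> \<le> Z * (\<Sum>i\<le>n. q ^ i)" by (simp add: u_def)
    also have "\<dots> \<le> Z * (1 / (1 - q))" using sum_le Z by (rule mult_left_mono)
    finally show ?thesis by simp
  qed
  have "u \<longlonglongrightarrow> t"
  proof (rule real_tendsto_sandwich)
    have fl: "real (nat \<lfloor>2 ^ n * (t / T)\<rfloor>) = of_int \<lfloor>2 ^ n * (t / T)\<rfloor>" for n :: nat
      using t T by simp
    show "\<forall>\<^sub>F n in sequentially. t - T * (1 / 2) ^ n \<le> u n"
    proof (intro always_eventually allI)
      fix n :: nat
      have "t - T * (1 / 2) ^ n = (2 ^ n * (t / T) - 1) * T / 2 ^ n"
        using T by (simp add: field_simps power_one_over)
      also have "\<dots> \<le> u n"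
        unfolding u_def fl using T by (intro divide_right_mono mult_right_mono) (linarith | simp)+
      finally show "t - T * (1 / 2) ^ n \<le> u n" .
    qed
    show "\<forall>\<^sub>F n in sequentially. u n \<le> t"
    proof (intro always_eventually allI)
      fix n :: nat
      have "u n \<le> (2 ^ n * (t / T)) * T / 2 ^ n"
        unfolding u_def fl using T by (intro divide_right_mono mult_right_mono) auto
      then show "u n \<le> t" using T by simp
    qed
    have "(\<lambda>n. t - T * (1 / 2) ^ n) \<longlonglongrightarrow> t - T * 0"
      by (intro tendsto_intros LIMSEQ_power_zero) simp
    then show "(\<lambda>n. t - T * (1 / 2) ^ n) \<longlonglongrightarrow> t" by simp
  qed simp
  then have "(\<lambda>n. f (u n)) \<longlonglongrightarrow> f t"
    using cont by (intro isCont_tendsto_compose[of t f]) (auto simp: continuous_on_eq_continuous_at)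
  then have "(\<lambda>n. \<bar>f (u n) - f 0\<bar>) \<longlonglongrightarrow> \<bar>f t - f 0\<bar>"
    by (intro tendsto_intros)
  then show ?thesis
    by (rule LIMSEQ_le_const2) (use bound in auto)
qed

context fbm_with_drift
begin

lemma exp_moment_abs_increment:
  assumes "u \<noteq> v" "0 \<le> a"
  shows "(\<integral>\<^sup>+\<omega>. ennreal (exp (a * \<bar>B v \<omega> - B u \<omega>\<bar>)) \<partial>M) \<le> ennreal (2 * exp (a\<^sup>2 * \<gamma> (v - u) / 2))"
proof -
  have *: "integrable M (\<lambda>\<omega>. exp (b * (B v \<omega> - B u \<omega>)))"
    "expectation (\<lambda>\<omega>. exp (b * (B v \<omega> - B u \<omega>))) = exp (b\<^sup>2 * \<gamma> (v - u) / 2)" for b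
  proof -
    let ?c = "\<lambda>t. if t = v then b else - b"
    have sum: "(\<Sum>t\<in>{u, v}. ?c t * B t \<omega>) = b * (B v \<omega> - B u \<omega>)" for \<omega>
      using assms by (simp add: algebra_simps)
    have var: "(\<Sum>s\<in>{u, v}. \<Sum>t\<in>{u, v}. ?c s * ?c t * (\<gamma> s + \<gamma> t - \<gamma> (s - t)) / 2) = b\<^sup>2 * \<gamma> (v - u)"
      using assms abs_minus_commute[of u v] by (simp add: power2_eq_square field_simps)
    show "integrable M (\<lambda>\<omega>. exp (b * (B v \<omega> - B u \<omega>)))"
      "expectation (\<lambda>\<omega>. exp (b * (B v \<omega> - B u \<omega>))) = exp (b\<^sup>2 * \<gamma> (v - u) / 2)"
      using exp_moment_B[of "{u, v}" ?c] unfolding sum var by simp_all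
  qed
  have "exp (a * \<bar>x\<bar>) \<le> exp (a * x) + exp ((- a) * x)" for x
    using exp_ge_zero[of "a * x"] exp_ge_zero[of "(- a) * x"] by (cases "0 \<le> x") auto
  then have "(\<integral>\<^sup>+\<omega>. ennreal (exp (a * \<bar>B v \<omega> - B u \<omega>\<bar>)) \<partial>M)
      \<le> (\<integral>\<^sup>+\<omega>. ennreal (exp (a * (B v \<omega> - B u \<omega>)) + exp ((- a) * (B v \<omega> - B u \<omega>))) \<partial>M)"
    by (intro nn_integral_mono ennreal_leI)
  also have "\<dots> = ennreal (2 * exp (a\<^sup>2 * \<gamma> (v - u) / 2))"
    using *[of a] *[of "- a"] by (subst nn_integral_eq_integral) auto
  finally show ?thesis .
qed

text \<open>Normalize the dyadic increments of level \<open>n\<close> by \<open>q^n\<close> with \<open>q = 2^(-\<alpha>/4)\<close>. The standard deviation of such an increment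
is of order \<open>q^(2 n)\<close> before and \<open>q^n\<close> after normalization; the remaining decay compensates for exponents that grow with \<open>n\<close>. If every normalized increment is at
most \<open>Z\<close>, chaining bounds \<open>sqrt 2 |B t|\<close> by \<open>l Z\<close> with \<open>l = sqrt 2 / (1 - q)\<close>. There are \<open>2^n\<close> increments of level \<open>n\<close>,
so a plain union bound for \<open>exp (l Z)\<close> diverges. Increments below \<open>1\<close> are therefore covered by the constant \<open>exp l\<close>,
and for the others \<open>exp (l z) \<le> exp (l z + 2 (n + 1) (z - 1))\<close> provides the factor \<open>exp (- 2 (n + 1))\<close>, which
beats \<open>2^n\<close>.\<close>

lemma nn_integral_exp_sup_finite:
  assumes T: "0 < T"
  shows "(\<integral>\<^sup>+\<omega>. ennreal (SUP t\<in>{0..T}. exp (W t \<omega>)) \<partial>M) < \<top>"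
proof -
  define q where "q = 2 powr (- \<alpha> / 4)"
  have q: "0 < q" "q < 1" using \<alpha>_pos by (simp_all add: q_def powr_less_one)
  define l where "l = sqrt 2 / (1 - q)"
  have l: "0 < l" using q by (simp add: l_def)
  define z where "z n k \<omega> = \<bar>B (real (Suc k) * T / 2 ^ n) \<omega> - B (real k * T / 2 ^ n) \<omega>\<bar> / q ^ n" for n k \<omega>
  define e where "e n k \<omega> = exp ((l + 2 * real (Suc n)) * z n k \<omega> - 2 * real (Suc n))" for n k \<omega>
  define R where "R \<omega> = ennreal (exp l) + (\<Sum>n. \<Sum>k<2 ^ n. ennreal (e n k \<omega>))" for \<omega>
  have [measurable]: "e n k \<in> borel_measurable M" for n k
    unfolding e_def[abs_def] z_def by measurable
  have R_ge_const: "ennreal (exp l) \<le> R \<omega>" for \<omega> by (simp add: R_def)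
  have R_ge_term: "ennreal (e n k \<omega>) \<le> R \<omega>" if k: "k < 2 ^ n" for \<omega> n k
  proof -
    have "ennreal (e n k \<omega>) \<le> (\<Sum>k<2 ^ n. ennreal (e n k \<omega>))"
      using k by (intro member_le_sum) auto
    also have "\<dots> \<le> (\<Sum>n. \<Sum>k<2 ^ n. ennreal (e n k \<omega>))"
      using sum_le_suminf[OF summableI, of "{n}" "\<lambda>n. \<Sum>k<2 ^ n. ennreal (e n k \<omega>)"] by simp
    also have "\<dots> \<le> R \<omega>" by (simp add: R_def)
    finally show "ennreal (e n k \<omega>) \<le> R \<omega>" .
  qed
  have dominated: "ennreal (SUP t\<in>{0..T}. exp (W t \<omega>)) \<le> R \<omega>" if \<omega>: "\<omega> \<in> space M" and B0: "B 0 \<omega> = 0" for \<omega>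
  proof (cases "R \<omega>")
    case (real r)
    then have r: "exp l \<le> r" "\<And>n k. k < 2 ^ n \<Longrightarrow> e n k \<omega> \<le> r"
      using R_ge_const[of \<omega>] R_ge_term[of _ _ \<omega>] real by auto
    have r_pos: "0 < r" using r(1) exp_gt_zero[of l] by linarith
    have ln_r: "l \<le> ln r" using r(1) r_pos by (simp add: ln_ge_iff)
    have "\<bar>B t \<omega> - B 0 \<omega>\<bar> \<le> (ln r / l) / (1 - q)" if "t \<in> {0..T}" for t
    proof (rule dyadic_chaining[OF continuous_B[OF \<omega>] T q _ _ that])
      show "0 \<le> ln r / l" using ln_r l by simp
      fix n k :: nat assume k: "k < 2 ^ n"
      have z0: "0 \<le> z n k \<omega>" using q by (simp add: z_def)
      have "l * z n k \<omega> \<le> ln r"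
      proof (cases "z n k \<omega> \<le> 1")
        case True
        then have "l * z n k \<omega> \<le> l" using l by simp
        with ln_r show ?thesis by simp
      next
        case False
        have "(l + 2 * real (Suc n)) * z n k \<omega> - 2 * real (Suc n) \<le> ln r"
          using r(2)[OF k] r_pos by (simp add: e_def ln_ge_iff del: of_nat_Suc)
        moreover have "0 \<le> 2 * real (Suc n) * (z n k \<omega> - 1)" using False by simp
        ultimately show ?thesis by (simp add: algebra_simps)
      qed
      then have "z n k \<omega> \<le> ln r / l" using l by (simp add: field_simps)
      then show "\<bar>B (real (Suc k) * T / 2 ^ n) \<omega> - B (real k * T / 2 ^ n) \<omega>\<bar> \<le> ln r / l * q ^ n"
        using q unfolding z_def by (simp add: pos_divide_le_eq)
    qed
    moreover have "sqrt 2 * ((ln r / l) / (1 - q)) = ln r"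
      using q by (simp add: l_def)
    ultimately have "sqrt 2 * \<bar>B t \<omega>\<bar> \<le> ln r" if "t \<in> {0..T}" for t
      using that B0 by (metis diff_zero mult_left_mono real_sqrt_ge_zero zero_le_numeral)
    then have "W t \<omega> \<le> ln r" if "t \<in> {0..T}" for t
    proof -
      have "sqrt 2 * B t \<omega> \<le> sqrt 2 * \<bar>B t \<omega>\<bar>" by simp
      moreover have "0 \<le> \<gamma> t" by simp
      ultimately show ?thesis
        using \<open>\<And>t. t \<in> {0..T} \<Longrightarrow> sqrt 2 * \<bar>B t \<omega>\<bar> \<le> ln r\<close>[OF that] unfolding W_process_def by linarith
    qed
    then have "exp (W t \<omega>) \<le> r" if "t \<in> {0..T}" for t
      using that r_pos by (simp flip: ln_ge_iff)
    then have "(SUP t\<in>{0..T}. exp (W t \<omega>)) \<le> r"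
      using T by (intro cSUP_least) auto
    with real show ?thesis by (simp add: ennreal_leI)
  qed simp
  \<comment> \<open>The exponents grow linearly in \<open>n\<close>, the standard deviations decay geometrically.\<close>
  obtain D where D: "\<And>n. \<bar>(l + 2 * real (Suc n)) * q ^ n\<bar> \<le> D"
  proof -
    have "(\<lambda>n. (l + 2) * q ^ n + 2 * (real n * q ^ n)) \<longlonglongrightarrow> (l + 2) * 0 + 2 * 0"
      using q by (intro tendsto_intros LIMSEQ_power_zero powser_times_n_limit_0) auto
    then have "Bseq (\<lambda>n. (l + 2) * q ^ n + 2 * (real n * q ^ n))"
      by (intro convergent_imp_Bseq convergentI)
    then obtain D where "\<And>n. \<bar>(l + 2) * q ^ n + 2 * (real n * q ^ n)\<bar> \<le> D"
      by (auto simp: Bseq_def)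
    then show ?thesis by (intro that[of D]) (simp add: algebra_simps)
  qed
  define K where "K = 2 * exp (D\<^sup>2 * T powr \<alpha> / 2)"
  have e_le: "(\<integral>\<^sup>+\<omega>. ennreal (e n k \<omega>) \<partial>M) \<le> ennreal (K * exp (- 2) ^ Suc n)" for n k
  proof -
    let ?a = "(l + 2 * real (Suc n)) / q ^ n"
    have "(\<integral>\<^sup>+\<omega>. ennreal (e n k \<omega>) \<partial>M) = (\<integral>\<^sup>+\<omega>. ennreal (exp (- 2) ^ Suc n) *
        ennreal (exp (?a * \<bar>B (real (Suc k) * T / 2 ^ n) \<omega> - B (real k * T / 2 ^ n) \<omega>\<bar>)) \<partial>M)"
      by (intro nn_integral_cong)
        (simp add: e_def z_def ennreal_mult[symmetric] exp_of_nat_mult[symmetric] exp_add[symmetric] del: power_Suc of_nat_Suc)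
    also have "\<dots> = ennreal (exp (- 2) ^ Suc n) *
        (\<integral>\<^sup>+\<omega>. ennreal (exp (?a * \<bar>B (real (Suc k) * T / 2 ^ n) \<omega> - B (real k * T / 2 ^ n) \<omega>\<bar>)) \<partial>M)"
      by (intro nn_integral_cmult) measurable
    also have "\<dots> \<le> ennreal (exp (- 2) ^ Suc n) *
        ennreal (2 * exp (?a\<^sup>2 * \<gamma> (real (Suc k) * T / 2 ^ n - real k * T / 2 ^ n) / 2))"
      using T l q by (intro mult_left_mono exp_moment_abs_increment) (auto simp: field_simps)
    also have "\<dots> \<le> ennreal (exp (- 2) ^ Suc n) * ennreal K"
    proof (intro mult_left_mono ennreal_leI)
      have "\<gamma> (real (Suc k) * T / 2 ^ n - real k * T / 2 ^ n) = (T / 2 ^ n) powr \<alpha>"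
        using T by (simp add: field_simps diff_divide_distrib[symmetric])
      \<comment> \<open>The variance of an increment is \<open>T^\<alpha> q^(4 n)\<close>; dividing the increment by \<open>q^n\<close> uses up two of the four factors.\<close>
      also have "\<dots> = T powr \<alpha> * (q ^ n) ^ 4"
      proof -
        have "(q ^ n) ^ 4 = (q ^ 4) ^ n" by (simp add: power_mult[symmetric] mult.commute)
        also have "q ^ 4 = 2 powr - \<alpha>" by (simp add: q_def powr_power)
        also have "(2 powr - \<alpha>) ^ n = 1 / (2 ^ n) powr \<alpha>"
        proof -
          have "(2 powr - \<alpha>) ^ n = (2 :: real) powr - (real n * \<alpha>)"
            by (simp add: powr_realpow[symmetric] powr_powr mult.commute)
          moreover have "(2 ^ n) powr \<alpha> = (2 :: real) powr (real n * \<alpha>)"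
            by (simp add: powr_realpow[symmetric] powr_powr)
          ultimately show ?thesis by (simp add: powr_minus_divide)
        qed
        finally show ?thesis using T by (simp add: powr_divide)
      qed
      finally have "?a\<^sup>2 * \<gamma> (real (Suc k) * T / 2 ^ n - real k * T / 2 ^ n)
          = ((l + 2 * real (Suc n)) * q ^ n)\<^sup>2 * T powr \<alpha>"
        using q by (simp add: field_simps power2_eq_square power4_eq_xxxx)
      also have "\<dots> \<le> D\<^sup>2 * T powr \<alpha>"
        using D[of n] by (intro mult_right_mono) (auto simp: abs_le_square_iff[symmetric])
      finally show "2 * exp (?a\<^sup>2 * \<gamma> (real (Suc k) * T / 2 ^ n - real k * T / 2 ^ n) / 2) \<le> K"
        unfolding K_def by simp
    qed simp
    also have "\<dots> = ennreal (K * exp (- 2) ^ Suc n)"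
      by (simp add: K_def ennreal_mult[symmetric] mult_ac)
    finally show ?thesis .
  qed
  have ratio: "2 * exp (- 2 :: real) < 1"
    using exp_ge_add_one_self[of "2 :: real"] by (simp add: exp_minus field_simps)
  have "(\<integral>\<^sup>+\<omega>. R \<omega> \<partial>M) = ennreal (exp l) + (\<Sum>n. \<Sum>k<2 ^ n. (\<integral>\<^sup>+\<omega>. ennreal (e n k \<omega>) \<partial>M))"
    unfolding R_def by (simp add: nn_integral_add nn_integral_suminf nn_integral_sum emeasure_space_1)
  also have "\<dots> \<le> ennreal (exp l) + (\<Sum>n. ennreal (K * exp (- 2) * (2 * exp (- 2)) ^ n))"
  proof (intro add_left_mono suminf_le summableI)
    fix n
    have "(\<Sum>k<2 ^ n. (\<integral>\<^sup>+\<omega>. ennreal (e n k \<omega>) \<partial>M)) \<le> (\<Sum>k<(2::nat) ^ n. ennreal (K * exp (- 2) ^ Suc n))"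
      by (intro sum_mono e_le)
    also have "\<dots> = ennreal (2 ^ n * (K * exp (- 2) ^ Suc n))"
      by (subst sum_ennreal) (auto simp: K_def)
    finally show "(\<Sum>k<2 ^ n. (\<integral>\<^sup>+\<omega>. ennreal (e n k \<omega>) \<partial>M)) \<le> ennreal (K * exp (- 2) * (2 * exp (- 2)) ^ n)"
      by (simp add: power_mult_distrib mult_ac)
  qed
  also have "\<dots> < \<top>"
  proof -
    have "summable (\<lambda>n. K * exp (- 2) * (2 * exp (- 2)) ^ n)"
      using ratio by (intro summable_mult summable_geometric) auto
    then have "(\<Sum>n. ennreal (K * exp (- 2) * (2 * exp (- 2)) ^ n)) \<noteq> \<top>"
      by (intro ennreal_suminf_neq_top) (auto simp: K_def)
    then show ?thesis by (simp add: less_top)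
  qed
  finally have "(\<integral>\<^sup>+\<omega>. R \<omega> \<partial>M) < \<top>" .
  moreover have "(\<integral>\<^sup>+\<omega>. ennreal (SUP t\<in>{0..T}. exp (W t \<omega>)) \<partial>M) \<le> (\<integral>\<^sup>+\<omega>. R \<omega> \<partial>M)"
    using AE_B_0 dominated by (intro nn_integral_mono_AE) auto
  ultimately show ?thesis by (rule le_less_trans[rotated])
qed

end

section \<open>Linear growth of the exponential supremum\<close>

lemma inverse_ennreal_antimono: "a \<le> b \<Longrightarrow> inverse b \<le> inverse (a :: ennreal)"
  including ennreal.lifting by transfer (auto intro: ereal_inverse_antimono)

lemma occupation_window_tendsto:
  assumes [measurable]: "f \<in> borel_measurable borel"
  shows "(\<lambda>n. occupation {- real n..real n} f) \<longlonglongrightarrow> occupation UNIV f"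
proof -
  let ?u = "\<lambda>n s. indicator {0<..} (f s) * indicator {- real n..real n} s :: ennreal"
  have "(\<lambda>n. \<integral>\<^sup>+s. ?u n s \<partial>lborel) \<longlonglongrightarrow> (\<integral>\<^sup>+s. indicator {0<..} (f s) \<partial>lborel)"
  proof (rule nn_integral_LIMSEQ)
    show "incseq ?u" by (auto simp: incseq_def le_fun_def indicator_def)
    show "(\<lambda>n. ?u n s) \<longlonglongrightarrow> indicator {0<..} (f s)" for s
    proof -
      obtain m :: nat where m: "\<bar>s\<bar> \<le> real m" using real_arch_simple by blast
      have "eventually (\<lambda>n. ?u n s = indicator {0<..} (f s)) sequentially"
        using eventually_ge_at_top[of m]
      proof eventually_elim
        case (elim n)
        then have "\<bar>s\<bar> \<le> real n" using m by linarith
        then have "s \<in> {- real n..real n}" by auto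
        then show ?case by simp
      qed
      then show ?thesis by (rule tendsto_eventually)
    qed
  qed simp
  then show ?thesis by (simp add: occupation_def)
qed

context fbm_with_drift
begin

lemma W_path_borel: "\<omega> \<in> space M \<Longrightarrow> (\<lambda>s. W s \<omega> + z) \<in> borel_measurable borel"
  by (intro borel_measurable_continuous_onI continuous_intros continuous_W)

lemma inverse_sojourn_antimono: "A \<subseteq> A' \<Longrightarrow> inverse_sojourn A' \<le> inverse_sojourn A"
  unfolding inverse_sojourn_def
  by (intro nn_integral_mono mult_left_mono inverse_ennreal_antimono occupation_mono) auto

lemma inverse_sojourn_window_measurable [measurable]:
  "(\<lambda>s. inverse_sojourn {- s..S - s}) \<in> borel_measurable borel"
proof -
  have [measurable]: "(\<lambda>x. occupation {- g x..S - g x} (\<lambda>u. W u (f x) + h x)) \<in> borel_measurable N"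
    if [measurable]: "f \<in> measurable N M" "g \<in> borel_measurable N" "h \<in> borel_measurable N"
    for f g h and N :: "'z measure"
  proof -
    have "occupation {- g x..S - g x} (\<lambda>u. W u (f x) + h x)
        = (\<integral>\<^sup>+u. indicator {0<..} (W u (f x) + h x) * (if - g x \<le> u \<and> u \<le> S - g x then 1 else 0) \<partial>lborel)" for x
      unfolding occupation_def by (intro nn_integral_cong) (auto simp: indicator_def)
    then show ?thesis by simp
  qed
  show ?thesis unfolding inverse_sojourn_def by measurable
qed

abbreviation exp_sup :: "real \<Rightarrow> ennreal" where
  "exp_sup S \<equiv> \<integral>\<^sup>+\<omega>. ennreal (SUP t\<in>{0..S}. exp (W t \<omega>)) \<partial>M"

lemma exp_sup_lower:
  assumes "0 < S"
  shows "ennreal S * inverse_sojourn UNIV \<le> exp_sup S"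
proof -
  have "ennreal S * inverse_sojourn UNIV = (\<integral>\<^sup>+s\<in>{0..S}. inverse_sojourn UNIV \<partial>lborel)"
    using assms by (subst nn_integral_cmult_indicator) (simp_all add: mult.commute)
  also have "\<dots> \<le> exp_sup S"
    unfolding nn_integral_exp_sup[OF assms]
    by (intro nn_integral_mono mult_right_mono inverse_sojourn_antimono) auto
  finally show ?thesis .
qed

text \<open>Times within \<open>R\<close> of an end of \<open>[0, S]\<close> are charged to the supremum over an interval of length \<open>R\<close>; for all others the
window contains \<open>[- R, R]\<close>.\<close>

lemma exp_sup_upper:
  assumes R: "0 < R" "2 * R \<le> S"
  shows "exp_sup S \<le> 2 * exp_sup R + ennreal S * inverse_sojourn {- R..R}"
proof -
  let ?h = "\<lambda>S s. inverse_sojourn {- s..S - s}"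
  have [measurable]: "(\<lambda>s. ?h R (s - (S - R))) \<in> borel_measurable borel"
    by (rule measurable_compose[OF _ inverse_sojourn_window_measurable]) measurable
  have meas: "(\<lambda>s. ?h R s * indicator {0..R} s) \<in> borel_measurable lborel"
    "(\<lambda>s. ?h R (s - (S - R)) * indicator {0..R} (s - (S - R))) \<in> borel_measurable lborel"
    "(\<lambda>s. inverse_sojourn {- R..R} * indicator {0..S} s) \<in> borel_measurable lborel"
    by measurable
  have "exp_sup S = (\<integral>\<^sup>+s\<in>{0..S}. ?h S s \<partial>lborel)"
    using R by (intro nn_integral_exp_sup) simp
  also have "\<dots> \<le> (\<integral>\<^sup>+s. ?h R s * indicator {0..R} s
      + ?h R (s - (S - R)) * indicator {0..R} (s - (S - R))
      + inverse_sojourn {- R..R} * indicator {0..S} s \<partial>lborel)"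
  proof (rule nn_integral_mono)
    fix s :: real
    consider "s \<notin> {0..S}" | "s \<in> {0..R}" | "s - (S - R) \<in> {0..R}" | "s \<in> {R..S - R}"
      using R by fastforce
    then show "?h S s * indicator {0..S} s \<le> ?h R s * indicator {0..R} s
      + ?h R (s - (S - R)) * indicator {0..R} (s - (S - R))
      + inverse_sojourn {- R..R} * indicator {0..S} s"
    proof cases
      case 1
      then show ?thesis by simp
    next
      case 2
      then have "?h S s \<le> ?h R s" using R by (intro inverse_sojourn_antimono) auto
      then show ?thesis using 2 R by (simp add: add_increasing2)
    next
      case 3
      then have "?h S s \<le> ?h R (s - (S - R))" using R by (intro inverse_sojourn_antimono) auto
      then show ?thesis using 3 R by (simp add: add_increasing add_increasing2)
    next
      case 4
      then have "?h S s \<le> inverse_sojourn {- R..R}" using R by (intro inverse_sojourn_antimono) auto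
      then show ?thesis using 4 R by (simp add: add_increasing)
    qed
  qed
  also have "\<dots> = (\<integral>\<^sup>+s\<in>{0..R}. ?h R s \<partial>lborel)
      + (\<integral>\<^sup>+s. ?h R (s - (S - R)) * indicator {0..R} (s - (S - R)) \<partial>lborel)
      + (\<integral>\<^sup>+s\<in>{0..S}. inverse_sojourn {- R..R} \<partial>lborel)"
    by (simp only: nn_integral_add meas borel_measurable_add)
  also have "(\<integral>\<^sup>+s. ?h R (s - (S - R)) * indicator {0..R} (s - (S - R)) \<partial>lborel)
      = (\<integral>\<^sup>+s\<in>{0..R}. ?h R s \<partial>lborel)"
    using meas(2) by (subst nn_integral_real_affine[where t = "S - R" and c = 1]) auto
  also have "(\<integral>\<^sup>+s\<in>{0..S}. inverse_sojourn {- R..R} \<partial>lborel) = ennreal S * inverse_sojourn {- R..R}"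
    using R by (subst nn_integral_cmult_indicator) (simp_all add: mult.commute)
  finally show ?thesis
    unfolding nn_integral_exp_sup[OF R(1)] by (simp add: mult_2 add_ac)
qed

text \<open>Finiteness is inherited from the expected supremum over \<open>[0, 1]\<close>, because every window \<open>[- s, 1 - s]\<close> in its
representation is contained in \<open>[- 1, 1]\<close>.\<close>

lemma inverse_sojourn_finite: "inverse_sojourn {- 1..1} < \<top>"
proof -
  have "inverse_sojourn {- 1..1} = (\<integral>\<^sup>+s\<in>{0..1::real}. inverse_sojourn {- 1..1} \<partial>lborel)"
    by (subst nn_integral_cmult_indicator) simp_all
  also have "\<dots> \<le> (\<integral>\<^sup>+s\<in>{0..1}. inverse_sojourn {- s..1 - s} \<partial>lborel)"
  proof (rule nn_integral_mono)
    fix s :: real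
    show "inverse_sojourn {- 1..1} * indicator {0..1} s \<le> inverse_sojourn {- s..1 - s} * indicator {0..1} s"
    proof (cases "s \<in> {0..1}")
      case True
      then show ?thesis by (intro mult_right_mono inverse_sojourn_antimono) auto
    qed simp
  qed
  also have "\<dots> = exp_sup 1" by (rule nn_integral_exp_sup[symmetric]) simp
  also have "\<dots> < \<top>" by (rule nn_integral_exp_sup_finite) simp
  finally show ?thesis .
qed

lemma inverse_sojourn_window_tendsto:
  "(\<lambda>n. inverse_sojourn {- real (Suc n)..real (Suc n)}) \<longlonglongrightarrow> inverse_sojourn UNIV"
proof -
  \<comment> \<open>As a single integral over level and sample point, the two nested limits become one dominated convergence.\<close>
  define u where "u A x = ennreal (exponential_density 1 (fst x)) *
      inverse (occupation A (\<lambda>s. W s (snd x) + fst x))" for A and x :: "real \<times> 'w"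
  have u [measurable]: "u A \<in> borel_measurable (lborel \<Otimes>\<^sub>M M)" if [measurable]: "A \<in> sets borel" for A
    unfolding u_def[abs_def] by measurable
  have product: "inverse_sojourn A = (\<integral>\<^sup>+x. u A x \<partial>(lborel \<Otimes>\<^sub>M M))" if [measurable]: "A \<in> sets borel" for A
  proof -
    have "(\<integral>\<^sup>+x. u A x \<partial>(lborel \<Otimes>\<^sub>M M)) = (\<integral>\<^sup>+z. \<integral>\<^sup>+\<omega>. u A (z, \<omega>) \<partial>M \<partial>lborel)"
      by (rule nn_integral_fst[symmetric]) measurable
    also have "\<dots> = inverse_sojourn A"
      unfolding inverse_sojourn_def u_def by (auto intro!: nn_integral_cong nn_integral_cmult)
    finally show ?thesis ..
  qed
  have "(\<lambda>n. \<integral>\<^sup>+x. u {- real (Suc n)..real (Suc n)} x \<partial>(lborel \<Otimes>\<^sub>M M)) \<longlonglongrightarrow> (\<integral>\<^sup>+x. u UNIV x \<partial>(lborel \<Otimes>\<^sub>M M))"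
  proof (rule nn_integral_dominated_convergence[where w = "u {- 1..1}"])
    show "AE x in lborel \<Otimes>\<^sub>M M. u {- real (Suc n)..real (Suc n)} x \<le> u {- 1..1} x" for n
      unfolding u_def by (intro AE_I2 mult_left_mono inverse_ennreal_antimono occupation_mono) auto
    show "(\<integral>\<^sup>+x. u {- 1..1} x \<partial>(lborel \<Otimes>\<^sub>M M)) < \<infinity>"
      using inverse_sojourn_finite by (simp add: product)
    show "AE x in lborel \<Otimes>\<^sub>M M. (\<lambda>n. u {- real (Suc n)..real (Suc n)} x) \<longlonglongrightarrow> u UNIV x"
    proof (rule AE_I2)
      fix x :: "real \<times> 'w" assume "x \<in> space (lborel \<Otimes>\<^sub>M M)"
      then have "snd x \<in> space M" by (auto simp: space_pair_measure)
      note LIMSEQ_Suc[OF occupation_window_tendsto[OF W_path_borel[OF this, of "fst x"]]]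
      moreover have "isCont inverse a" for a :: ennreal
        using continuous_on_inverse_ennreal[OF continuous_on_id, of UNIV]
        by (simp add: continuous_on_eq_continuous_at)
      ultimately have "(\<lambda>n. inverse (occupation {- real (Suc n)..real (Suc n)} (\<lambda>s. W s (snd x) + fst x)))
          \<longlonglongrightarrow> inverse (occupation UNIV (\<lambda>s. W s (snd x) + fst x))"
        by (rule isCont_tendsto_compose[rotated])
      then show "(\<lambda>n. u {- real (Suc n)..real (Suc n)} x) \<longlonglongrightarrow> u UNIV x"
        unfolding u_def by (intro ennreal_tendsto_cmult) auto
    qed
  qed measurable
  then show ?thesis by (simp add: product)
qed

text \<open>The lower bound \<open>exp_sup_lower\<close> holds for every \<open>S\<close>. In \<open>exp_sup_upper\<close> the window \<open>[- R, R]\<close> is fixed first, so that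
its end terms vanish in the limit \<open>S \<rightarrow> \<infinity>\<close>, and is enlarged afterwards.\<close>

lemma exp_sup_rate:
  "((\<lambda>S. inverse S * enn2real (exp_sup S)) \<longlongrightarrow> enn2real (inverse_sojourn UNIV)) at_top"
proof -
  define a where "a S = enn2real (exp_sup S)" for S
  define c where "c n = enn2real (inverse_sojourn {- real (Suc n)..real (Suc n)})" for n
  define d where "d = enn2real (inverse_sojourn UNIV)"
  have fin_c: "inverse_sojourn {- real (Suc n)..real (Suc n)} < \<top>" for n
    using inverse_sojourn_antimono[of "{- 1..1}" "{- real (Suc n)..real (Suc n)}"] inverse_sojourn_finite
    by (auto intro: le_less_trans)
  have fin_d: "inverse_sojourn UNIV < \<top>"
    using inverse_sojourn_antimono[of "{- 1..1}" UNIV] inverse_sojourn_finite by (auto intro: le_less_trans)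
  have exp_sup: "exp_sup S = ennreal (a S)" if "0 < S" for S
    using nn_integral_exp_sup_finite[OF that] by (simp add: a_def less_top)
  have c: "inverse_sojourn {- real (Suc n)..real (Suc n)} = ennreal (c n)" for n
    using fin_c by (simp add: c_def less_top del: of_nat_Suc)
  have d: "inverse_sojourn UNIV = ennreal d"
    using fin_d by (simp add: d_def less_top)
  have nonneg: "0 \<le> a S" "0 \<le> c n" "0 \<le> d" for S n by (simp_all add: a_def c_def d_def)
  have lower: "S * d \<le> a S" if "0 < S" for S
    using exp_sup_lower[OF that] that nonneg unfolding d exp_sup[OF that]
    by (simp add: ennreal_mult[symmetric])
  have upper: "a S \<le> 2 * a (real (Suc n)) + S * c n" if "2 * real (Suc n) \<le> S" for S n
  proof -
    have S: "0 < S" using that by simp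
    have "ennreal (a S) \<le> 2 * ennreal (a (real (Suc n))) + ennreal S * ennreal (c n)"
      using exp_sup_upper[of "real (Suc n)" S] that unfolding exp_sup[OF S] c[symmetric]
      by (simp add: exp_sup del: of_nat_Suc)
    also have "\<dots> = ennreal (2 * a (real (Suc n)) + S * c n)"
      using nonneg S by (simp add: ennreal_mult ennreal_plus)
    finally show ?thesis using nonneg S by (subst (asm) ennreal_le_iff) simp_all
  qed
  have c_lim: "c \<longlonglongrightarrow> d"
    using tendsto_enn2real[OF inverse_sojourn_window_tendsto[unfolded d]] nonneg
    unfolding c_def d_def[symmetric] d by (simp add: d_def[symmetric])
  have "((\<lambda>S. inverse S * a S) \<longlongrightarrow> d) at_top"
  proof (rule order_tendstoI)
    fix b assume "b < d"
    show "\<forall>\<^sub>F S in at_top. b < inverse S * a S"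
      using eventually_gt_at_top[of 0]
    proof eventually_elim
      case (elim S)
      then have "d \<le> inverse S * a S" using lower[OF elim] by (simp add: field_simps)
      with \<open>b < d\<close> show ?case by simp
    qed
  next
    fix b assume "d < b"
    then obtain n where n: "c n < b"
      using order_tendstoD(2)[OF c_lim] by (auto simp: eventually_sequentially)
    have "((\<lambda>S. inverse S * (2 * a (real (Suc n))) + c n) \<longlongrightarrow> 0 * (2 * a (real (Suc n))) + c n) at_top"
      by (intro tendsto_intros tendsto_inverse_0_at_top filterlim_ident)
    then have "\<forall>\<^sub>F S in at_top. inverse S * (2 * a (real (Suc n))) + c n < b"
      using n by (intro order_tendstoD(2)) auto
    then show "\<forall>\<^sub>F S in at_top. inverse S * a S < b"
      using eventually_ge_at_top[of "2 * real (Suc n)"]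
    proof eventually_elim
      case (elim S)
      then have S: "0 < S" by simp
      have "inverse S * a S \<le> inverse S * (2 * a (real (Suc n)) + S * c n)"
        using S upper[OF elim(2)] by (intro mult_left_mono) auto
      also have "\<dots> = inverse S * (2 * a (real (Suc n))) + c n" using S by (simp add: field_simps)
      finally show ?case using elim by simp
    qed
  qed
  then show ?thesis by (simp add: a_def d_def)
qed

lemma exp_sup_measurable:
  assumes "0 < S"
  shows "(\<lambda>\<omega>. SUP t\<in>{0..S}. exp (W t \<omega>)) \<in> borel_measurable M"
proof -
  let ?N = "\<lambda>\<omega>. \<integral>\<^sup>+y. (\<integral>\<^sup>+s\<in>{0..S}. (ennreal (exp (- y)) * (indicator {0<..} (W s \<omega> + y) *
         inverse (occupation {0..S} (\<lambda>u. W u \<omega> + y)))) \<partial>lborel) \<partial>lborel"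
  have "(\<lambda>\<omega>. enn2real (?N \<omega>)) \<in> borel_measurable M" by measurable
  also have "?this \<longleftrightarrow> ?thesis"
  proof (intro measurable_cong)
    fix \<omega> assume \<omega>: "\<omega> \<in> space M"
    show "enn2real (?N \<omega>) = (SUP t\<in>{0..S}. exp (W t \<omega>))"
      unfolding exp_sup_eq_nn_integral[OF continuous_W[OF \<omega>] assms, symmetric]
      using exp_sup_nonneg[OF continuous_W[OF \<omega>] assms] by simp
  qed
  finally show ?thesis .
qed

lemma pickands_constant_eq_inverse_sojourn:
  "pickands_constant M \<alpha> B = enn2real (inverse_sojourn UNIV)"
  unfolding pickands_constant_def
proof (rule tendsto_Lim)
  show "((\<lambda>S. inverse S * expectation (\<lambda>\<omega>. SUP t\<in>{0..S}. exp (W t \<omega>))) \<longlongrightarrow> enn2real (inverse_sojourn UNIV)) at_top"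
  proof (rule Lim_transform_eventually[OF exp_sup_rate])
    show "\<forall>\<^sub>F S in at_top. inverse S * enn2real (exp_sup S)
        = inverse S * expectation (\<lambda>\<omega>. SUP t\<in>{0..S}. exp (W t \<omega>))"
      using eventually_gt_at_top[of 0]
    proof eventually_elim
      case (elim S)
      then show ?case
        using exp_sup_nonneg[OF continuous_W]
        by (subst integral_eq_nn_integral) (auto intro: exp_sup_measurable)
    qed
  qed
qed simp

end

section \<open>Independence of a random variable and a process\<close>

lemma (in prob_space) joint_law_indep_of_process:
  fixes X :: "real \<Rightarrow> 'a \<Rightarrow> real"
  assumes [measurable]: "Y \<in> borel_measurable M" "\<And>t. X t \<in> borel_measurable M"
    and indep: "indep_of_process M Y X"
  shows "distr M (borel \<Otimes>\<^sub>M (\<Pi>\<^sub>M t\<in>UNIV. borel)) (\<lambda>\<omega>. (Y \<omega>, \<lambda>t. X t \<omega>))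
    = distr M borel Y \<Otimes>\<^sub>M distr M (\<Pi>\<^sub>M t\<in>UNIV. borel) (\<lambda>\<omega> t. X t \<omega>)"
proof (rule pair_measure_eqI[symmetric])
  have path [measurable]: "(\<lambda>\<omega> t. X t \<omega>) \<in> measurable M (\<Pi>\<^sub>M t\<in>UNIV. borel)"
    by (rule measurable_PiM_single') auto
  show "sigma_finite_measure (distr M borel Y)"
    by (intro prob_space_imp_sigma_finite prob_space_distr) simp
  show "sigma_finite_measure (distr M (\<Pi>\<^sub>M t\<in>UNIV. borel) (\<lambda>\<omega> t. X t \<omega>))"
    by (intro prob_space_imp_sigma_finite prob_space_distr) simp
  fix A C assume A: "A \<in> sets (distr M borel Y)"
    and C: "C \<in> sets (distr M (\<Pi>\<^sub>M t\<in>UNIV. borel) (\<lambda>\<omega> t. X t \<omega>))"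
  then have [measurable]: "A \<in> sets borel" "C \<in> sets (\<Pi>\<^sub>M t\<in>UNIV. borel)" by simp_all
  let ?a = "Y -` A \<inter> space M" and ?c = "(\<lambda>\<omega> t. X t \<omega>) -` C \<inter> space M"
  have "?a \<in> sets (vimage_algebra (space M) Y borel)"
    "?c \<in> sets (vimage_algebra (space M) (\<lambda>\<omega> t. X t \<omega>) (\<Pi>\<^sub>M t\<in>UNIV. borel))"
    by (simp_all add: in_vimage_algebra)
  then have "prob (?a \<inter> ?c) = prob ?a * prob ?c"
    using indep by (intro indep_setD) (auto simp: indep_of_process_def)
  moreover have "(\<lambda>\<omega>. (Y \<omega>, \<lambda>t. X t \<omega>)) -` (A \<times> C) \<inter> space M = ?a \<inter> ?c" by auto
  ultimately show "emeasure (distr M borel Y) A * emeasure (distr M (\<Pi>\<^sub>M t\<in>UNIV. borel) (\<lambda>\<omega> t. X t \<omega>)) C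
      = emeasure (distr M (borel \<Otimes>\<^sub>M (\<Pi>\<^sub>M t\<in>UNIV. borel)) (\<lambda>\<omega>. (Y \<omega>, \<lambda>t. X t \<omega>))) (A \<times> C)"
    by (simp add: emeasure_distr emeasure_eq_measure ennreal_mult)
qed simp

lemma (in prob_space) nn_integral_indep_of_process:
  fixes X :: "real \<Rightarrow> 'a \<Rightarrow> real"
  assumes D: "distributed M lborel Y g" and X [measurable]: "\<And>t. X t \<in> borel_measurable M"
    and indep: "indep_of_process M Y X"
    and F [measurable]: "case_prod F \<in> borel_measurable (borel \<Otimes>\<^sub>M (\<Pi>\<^sub>M t\<in>UNIV. borel))"
  shows "(\<integral>\<^sup>+\<omega>. F (Y \<omega>) (\<lambda>t. X t \<omega>) \<partial>M) = (\<integral>\<^sup>+y. g y * (\<integral>\<^sup>+\<omega>. F y (\<lambda>t. X t \<omega>) \<partial>M) \<partial>lborel)"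
proof -
  have Y [measurable]: "Y \<in> borel_measurable M" using distributed_measurable[OF D] by simp
  have path [measurable]: "(\<lambda>\<omega> t. X t \<omega>) \<in> measurable M (\<Pi>\<^sub>M t\<in>UNIV. borel)"
    by (rule measurable_PiM_single') auto
  let ?law = "distr M (\<Pi>\<^sub>M t\<in>UNIV. borel) (\<lambda>\<omega> t. X t \<omega>)"
  interpret law: prob_space ?law by (rule prob_space_distr) simp
  have "(\<integral>\<^sup>+\<omega>. F (Y \<omega>) (\<lambda>t. X t \<omega>) \<partial>M)
      = (\<integral>\<^sup>+x. case_prod F x \<partial>distr M (borel \<Otimes>\<^sub>M (\<Pi>\<^sub>M t\<in>UNIV. borel)) (\<lambda>\<omega>. (Y \<omega>, \<lambda>t. X t \<omega>)))"
    by (subst nn_integral_distr) auto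
  also have "\<dots> = (\<integral>\<^sup>+x. case_prod F x \<partial>(distr M borel Y \<Otimes>\<^sub>M ?law))"
    by (simp only: joint_law_indep_of_process[OF Y X indep])
  also have "\<dots> = (\<integral>\<^sup>+y. (\<integral>\<^sup>+f. F y f \<partial>?law) \<partial>distr M borel Y)"
    by (subst law.nn_integral_fst[symmetric]) auto
  also have "\<dots> = (\<integral>\<^sup>+y. (\<integral>\<^sup>+\<omega>. F y (\<lambda>t. X t \<omega>) \<partial>M) \<partial>distr M borel Y)"
    by (intro nn_integral_cong) (subst nn_integral_distr, auto)
  also have "\<dots> = (\<integral>\<^sup>+\<omega>'. (\<integral>\<^sup>+\<omega>. F (Y \<omega>') (\<lambda>t. X t \<omega>) \<partial>M) \<partial>M)"
    by (subst nn_integral_distr) auto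
  also have "\<dots> = (\<integral>\<^sup>+y. g y * (\<integral>\<^sup>+\<omega>. F y (\<lambda>t. X t \<omega>) \<partial>M) \<partial>lborel)"
    by (rule distributed_nn_integral[OF D, symmetric]) measurable
  finally show ?thesis .
qed

section \<open>The mean sojourn time\<close>

lemma nn_integral_powr_Ioo:
  assumes "0 \<le> b" "-1 < p"
  shows "(\<integral>\<^sup>+y\<in>{0<..<b}. ennreal (y powr p) \<partial>lborel) = ennreal (b powr (p + 1) / (p + 1))"
proof -
  have "(\<integral>\<^sup>+y\<in>{0<..<b}. ennreal (y powr p) \<partial>lborel) = (\<integral>\<^sup>+y. ennreal (indicator {0..b} y * y powr p) \<partial>lborel)"
    by (intro nn_integral_cong_AE, rule AE_mp[OF AE_lborel_singleton[of 0]],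
        rule AE_mp[OF AE_lborel_singleton[of b]])
      (auto simp: indicator_def)
  also have "\<dots> = ennreal (b powr (p + 1) / (p + 1))"
    using has_integral_powr_from_0[of p b] assms
    by (intro nn_integral_has_integral_lebesgue) auto
  finally show ?thesis .
qed

lemma nn_integral_Gamma:
  assumes "0 < x"
  shows "(\<integral>\<^sup>+u\<in>{0<..}. ennreal (u powr (x - 1) * exp (- u)) \<partial>lborel) = ennreal (Gamma x)"
proof -
  have "(\<integral>\<^sup>+u\<in>{0<..}. ennreal (u powr (x - 1) * exp (- u)) \<partial>lborel)
      = (\<integral>\<^sup>+u. ennreal (indicator {0..} u * (u powr (x - 1) / exp u)) \<partial>lborel)"
    by (intro nn_integral_cong_AE, rule AE_mp[OF AE_lborel_singleton[of 0]])
      (auto simp: indicator_def exp_minus field_simps)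
  also have "\<dots> = ennreal (Gamma x)"
    using Gamma_integral_real[OF assms] by (intro nn_integral_has_integral_lebesgue) auto
  finally show ?thesis .
qed

text \<open>Writing \<open>exp (- y^2 / 2)\<close> as the integral of \<open>exp (- u)\<close> over \<open>u > y^2 / 2\<close> and integrating in \<open>y\<close> first reduces
the moment to a Gamma integral.\<close>

lemma std_normal_half_moment:
  assumes p: "0 < p"
  shows "(\<integral>\<^sup>+y\<in>{0<..}. ennreal (std_normal_density y * y powr p) \<partial>lborel)
    = ennreal (2 powr (p / 2) * Gamma ((p + 1) / 2) / (2 * sqrt pi))"
proof -
  let ?c = "1 / sqrt (2 * pi)"
  have "(\<integral>\<^sup>+y\<in>{0<..}. ennreal (std_normal_density y * y powr p) \<partial>lborel)
      = (\<integral>\<^sup>+y. (\<integral>\<^sup>+u. ennreal ?c * (ennreal (exp (- u)) * (ennreal (y powr p) *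
           (indicator {0<..} y * indicator {y\<^sup>2 / 2<..} u))) \<partial>lborel) \<partial>lborel)"
  proof (rule nn_integral_cong)
    fix y :: real
    have "(\<integral>\<^sup>+u. ennreal ?c * (ennreal (exp (- u)) * (ennreal (y powr p) *
           (indicator {0<..} y * indicator {y\<^sup>2 / 2<..} u))) \<partial>lborel)
        = (\<integral>\<^sup>+u. (ennreal ?c * ennreal (y powr p) * indicator {0<..} y) *
           (ennreal (exp (- u)) * indicator {y\<^sup>2 / 2<..} u) \<partial>lborel)"
      by (intro nn_integral_cong) (simp add: mult_ac)
    also have "\<dots> = (ennreal ?c * ennreal (y powr p) * indicator {0<..} y) * ennreal (exp (- (y\<^sup>2 / 2)))"
      by (subst nn_integral_cmult) (simp_all add: nn_integral_exp_tail)
    also have "\<dots> = ennreal (std_normal_density y * y powr p) * indicator {0<..} y"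
      by (auto simp: std_normal_density_def ennreal_mult[symmetric] mult_ac indicator_def)
    finally show "ennreal (std_normal_density y * y powr p) * indicator {0<..} y = (\<integral>\<^sup>+u. ennreal ?c * (ennreal (exp (- u)) * (ennreal (y powr p) *
           (indicator {0<..} y * indicator {y\<^sup>2 / 2<..} u))) \<partial>lborel)" ..
  qed
  also have "\<dots> = (\<integral>\<^sup>+u. (\<integral>\<^sup>+y. ennreal ?c * (ennreal (exp (- u)) * (ennreal (y powr p) *
           (indicator {0<..} y * indicator {y\<^sup>2 / 2<..} u))) \<partial>lborel) \<partial>lborel)"
  proof (rule lborel_pair.Fubini')
    have [measurable]: "(\<lambda>x::real \<times> real. indicator {(fst x)\<^sup>2 / 2<..} (snd x) :: ennreal) \<in> borel_measurable (borel \<Otimes>\<^sub>M borel)"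
      unfolding indicator_def greaterThan_iff by measurable
    show "(\<lambda>(u, y). ennreal ?c * (ennreal (exp (- u)) * (ennreal (y powr p) *
           (indicator {0<..} y * indicator {y\<^sup>2 / 2<..} u)))) \<in> borel_measurable (lborel \<Otimes>\<^sub>M lborel)"
      unfolding indicator_def greaterThan_iff by measurable
  qed
  also have "\<dots> = (\<integral>\<^sup>+u. ennreal (?c * 2 powr ((p + 1) / 2) / (p + 1)) *
      (ennreal (u powr ((p + 3) / 2 - 1) * exp (- u)) * indicator {0<..} u) \<partial>lborel)"
  proof (rule nn_integral_cong)
    fix u :: real
    show "(\<integral>\<^sup>+y. ennreal ?c * (ennreal (exp (- u)) * (ennreal (y powr p) *
           (indicator {0<..} y * indicator {y\<^sup>2 / 2<..} u))) \<partial>lborel)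
        = ennreal (?c * 2 powr ((p + 1) / 2) / (p + 1)) *
          (ennreal (u powr ((p + 3) / 2 - 1) * exp (- u)) * indicator {0<..} u)"
    proof (cases "0 < u")
      case True
      have dom: "0 < y \<and> y\<^sup>2 / 2 < u \<longleftrightarrow> y \<in> {0<..<sqrt (2 * u)}" for y
      proof -
        have "y\<^sup>2 < 2 * u" if "0 < y" "y < sqrt (2 * u)"
          using power_strict_mono[OF that(2), of 2] that True by simp
        then show ?thesis by (auto intro: real_less_rsqrt)
      qed
      have "(\<integral>\<^sup>+y. ennreal ?c * (ennreal (exp (- u)) * (ennreal (y powr p) *
           (indicator {0<..} y * indicator {y\<^sup>2 / 2<..} u))) \<partial>lborel)
          = (\<integral>\<^sup>+y. ennreal (?c * exp (- u)) * (ennreal (y powr p) * indicator {0<..<sqrt (2 * u)} y) \<partial>lborel)"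
      proof (rule nn_integral_cong)
        fix y :: real
        have "indicator {0<..} y * indicator {y\<^sup>2 / 2<..} u = (indicator {0<..<sqrt (2 * u)} y :: ennreal)"
          using dom[of y] by (auto simp: indicator_def)
        then show "ennreal ?c * (ennreal (exp (- u)) * (ennreal (y powr p) *
           (indicator {0<..} y * indicator {y\<^sup>2 / 2<..} u)))
          = ennreal (?c * exp (- u)) * (ennreal (y powr p) * indicator {0<..<sqrt (2 * u)} y)"
          by (simp only: ennreal_mult'' exp_ge_zero mult.assoc)
      qed
      also have "\<dots> = ennreal (?c * exp (- u)) * ennreal (sqrt (2 * u) powr (p + 1) / (p + 1))"
        using p True by (subst nn_integral_cmult) (simp_all add: nn_integral_powr_Ioo)
      also have "sqrt (2 * u) powr (p + 1) = 2 powr ((p + 1) / 2) * u powr ((p + 3) / 2 - 1)"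
        using True by (simp add: powr_half_sqrt[symmetric] powr_powr powr_mult diff_divide_distrib add_divide_distrib add.commute)
      finally show ?thesis
        using True p by (simp add: ennreal_mult[symmetric] mult_ac)
    next
      case False
      then have "indicator {y\<^sup>2 / 2<..} u = (0 :: ennreal)" for y
      proof -
        have "\<not> y\<^sup>2 / 2 < u" using False zero_le_power2[of y] by linarith
        then show ?thesis by (simp only: indicator_def greaterThan_iff if_False of_bool_eq)
      qed
      then show ?thesis using False by simp
    qed
  qed
  also have "\<dots> = ennreal (?c * 2 powr ((p + 1) / 2) / (p + 1)) * ennreal (Gamma ((p + 3) / 2))"
    using p by (subst nn_integral_cmult) (simp_all add: nn_integral_Gamma)
  also have "\<dots> = ennreal (2 powr (p / 2) * Gamma ((p + 1) / 2) / (2 * sqrt pi))"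
  proof -
    have "(p + 1) / 2 \<notin> \<int>\<^sub>\<le>\<^sub>0" using p nonpos_Ints_nonpos[of "(p + 1) / 2"] by force
    then have "Gamma ((p + 3) / 2) = (p + 1) / 2 * Gamma ((p + 1) / 2)"
      using Gamma_plus1[of "(p + 1) / 2"] by (simp add: add_divide_distrib add.commute)
    moreover have "2 powr ((p + 1) / 2) = 2 powr (p / 2) * sqrt 2"
      by (simp add: add_divide_distrib powr_add powr_half_sqrt)
    moreover have "(1 / (r * q) * (t * r) / (p + 1)) * ((p + 1) / 2 * g) = t * g / (2 * q)"
      if "r \<noteq> 0" "q \<noteq> 0" for r q t g :: real
    proof -
      have "p + 1 \<noteq> 0" using p by simp
      with that show ?thesis by (simp add: divide_simps)
    qed
    ultimately have "(?c * 2 powr ((p + 1) / 2) / (p + 1)) * Gamma ((p + 3) / 2)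
        = 2 powr (p / 2) * Gamma ((p + 1) / 2) / (2 * sqrt pi)"
      by (simp only: real_sqrt_mult) simp
    then show ?thesis using p by (simp add: ennreal_mult[symmetric])
  qed
  finally show ?thesis .
qed

lemma nn_integral_exponential_tail:
  "(\<integral>\<^sup>+z. ennreal (exponential_density 1 z) * indicator {0<..} (w + z) \<partial>lborel) = ennreal (min 1 (exp w))"
proof -
  define a where "a = max 0 (- w)"
  have "(\<integral>\<^sup>+z. ennreal (exponential_density 1 z) * indicator {0<..} (w + z) \<partial>lborel)
      = (\<integral>\<^sup>+z\<in>{a<..}. ennreal (exp (- z)) \<partial>lborel)"
    by (intro nn_integral_cong_AE, rule AE_mp[OF AE_lborel_singleton[of 0]])
      (auto simp: indicator_def exponential_density_def a_def max_def)
  also have "\<dots> = ennreal (exp (- a))" by (rule nn_integral_exp_tail)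
  also have "exp (- a) = min 1 (exp w)" by (auto simp: a_def max_def min_def)
  finally show ?thesis .
qed

text \<open>The factor \<open>exp (2 a y - 2 a^2)\<close> reflects the normal density at \<open>a\<close>, so the parts below and above \<open>a\<close> contribute
equally.\<close>

lemma nn_integral_min_exp_std_normal:
  assumes "0 < a"
  shows "(\<integral>\<^sup>+y. ennreal (std_normal_density y) * ennreal (min 1 (exp (2 * a * y - 2 * a\<^sup>2))) \<partial>lborel)
    = 2 * (\<integral>\<^sup>+y\<in>{a<..}. ennreal (std_normal_density y) \<partial>lborel)"
proof -
  let ?\<phi> = "std_normal_density"
  have reflect: "?\<phi> y * exp (2 * a * y - 2 * a\<^sup>2) = ?\<phi> (2 * a - y)" for y
  proof -
    have "exp (- y\<^sup>2 / 2) * exp (2 * a * y - 2 * a\<^sup>2) = exp (- (2 * a - y)\<^sup>2 / 2)"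
      unfolding exp_add[symmetric] by (rule arg_cong[where f = exp]) (simp add: power2_eq_square field_simps)
    then show ?thesis by (simp add: std_normal_density_def)
  qed
  have "(\<integral>\<^sup>+y. ennreal (?\<phi> y) * ennreal (min 1 (exp (2 * a * y - 2 * a\<^sup>2))) \<partial>lborel)
      = (\<integral>\<^sup>+y. ennreal (?\<phi> y) * indicator {a<..} y + ennreal (?\<phi> (2 * a - y)) * indicator {..<a} y \<partial>lborel)"
  proof (rule nn_integral_cong_AE, rule AE_mp[OF AE_lborel_singleton[of a]], intro AE_I2 impI)
    fix y assume "y \<noteq> a"
    have "2 * a * y - 2 * a\<^sup>2 = 2 * a * (y - a)" by (simp add: power2_eq_square algebra_simps)
    then have "0 \<le> 2 * a * y - 2 * a\<^sup>2 \<longleftrightarrow> a \<le> y" using assms by (simp add: zero_le_mult_iff)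
    with \<open>y \<noteq> a\<close> show "ennreal (?\<phi> y) * ennreal (min 1 (exp (2 * a * y - 2 * a\<^sup>2)))
        = ennreal (?\<phi> y) * indicator {a<..} y + ennreal (?\<phi> (2 * a - y)) * indicator {..<a} y"
      by (auto simp: reflect[symmetric] ennreal_mult min_def indicator_def)
  qed
  also have "\<dots> = (\<integral>\<^sup>+y\<in>{a<..}. ennreal (?\<phi> y) \<partial>lborel) + (\<integral>\<^sup>+y\<in>{..<a}. ennreal (?\<phi> (2 * a - y)) \<partial>lborel)"
    by (rule nn_integral_add) measurable
  also have "(\<integral>\<^sup>+y\<in>{..<a}. ennreal (?\<phi> (2 * a - y)) \<partial>lborel)
      = (\<integral>\<^sup>+y. ennreal (?\<phi> (2 * a - (2 * a + (-1) * y))) * indicator {..<a} (2 * a + (-1) * y) \<partial>lborel)"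
    by (subst nn_integral_real_affine[where t = "2 * a" and c = "-1"]) auto
  also have "\<dots> = (\<integral>\<^sup>+y\<in>{a<..}. ennreal (?\<phi> y) \<partial>lborel)"
    by (intro nn_integral_cong) (auto simp: indicator_def)
  finally show ?thesis unfolding mult_2 .
qed

context fbm_with_drift
begin

lemma square_powr_half: "(\<bar>s\<bar> powr (\<alpha> / 2))\<^sup>2 = \<gamma> s"
  by (simp add: power2_eq_square flip: powr_add)

lemma normal_B_marginal:
  assumes "s \<noteq> 0"
  shows "distributed M lborel (B s) (\<lambda>x. ennreal (normal_density 0 (\<bar>s\<bar> powr (\<alpha> / 2)) x))"
proof -
  obtain \<sigma> where N: "normal_rv M (\<lambda>\<omega>. \<Sum>t\<in>{s}. 1 * B t \<omega>) 0 \<sigma>"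
    and \<sigma>: "\<sigma>\<^sup>2 = (\<Sum>u\<in>{s}. \<Sum>t\<in>{s}. 1 * 1 * (\<gamma> u + \<gamma> t - \<gamma> (u - t)) / 2)"
    using normal_sum_B[of "{s}" "\<lambda>_. 1"] by blast
  have "\<sigma>\<^sup>2 = (\<bar>s\<bar> powr (\<alpha> / 2))\<^sup>2"
    using \<sigma> by (simp add: square_powr_half)
  moreover have "0 \<le> \<sigma>" using N by (simp add: normal_rv_def)
  ultimately have "\<sigma> = \<bar>s\<bar> powr (\<alpha> / 2)" by (simp add: power2_eq_iff_nonneg)
  with N assms show ?thesis by (simp add: normal_rv_def)
qed

lemma nn_integral_min_exp_W:
  assumes "s \<noteq> 0"
  shows "(\<integral>\<^sup>+\<omega>. ennreal (min 1 (exp (W s \<omega>))) \<partial>M)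
    = 2 * (\<integral>\<^sup>+y\<in>{\<bar>s\<bar> powr (\<alpha> / 2) / sqrt 2<..}. ennreal (std_normal_density y) \<partial>lborel)"
proof -
  define \<sigma> where "\<sigma> = \<bar>s\<bar> powr (\<alpha> / 2)"
  have \<sigma>: "0 < \<sigma>" "\<sigma>\<^sup>2 = \<gamma> s" using assms by (simp_all add: \<sigma>_def square_powr_half)
  have scale: "\<sigma> * normal_density 0 \<sigma> (\<sigma> * y) = std_normal_density y" for y
    using \<sigma>(1) by (simp add: normal_density_def power_mult_distrib real_sqrt_mult)
  have expo: "sqrt 2 * (\<sigma> * y) - \<gamma> s = 2 * (\<sigma> / sqrt 2) * y - 2 * (\<sigma> / sqrt 2)\<^sup>2" for y
    by (simp add: \<sigma>(2)[symmetric] power_divide real_div_sqrt field_simps)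
  have "(\<integral>\<^sup>+\<omega>. ennreal (min 1 (exp (W s \<omega>))) \<partial>M)
      = (\<integral>\<^sup>+x. ennreal (normal_density 0 \<sigma> x) * ennreal (min 1 (exp (sqrt 2 * x - \<gamma> s))) \<partial>lborel)"
    unfolding W_process_def \<sigma>_def
    by (rule distributed_nn_integral[OF normal_B_marginal[OF assms], symmetric]) measurable
  also have "\<dots> = ennreal \<sigma> * (\<integral>\<^sup>+y. ennreal (normal_density 0 \<sigma> (\<sigma> * y)) * ennreal (min 1 (exp (sqrt 2 * (\<sigma> * y) - \<gamma> s))) \<partial>lborel)"
    using \<sigma> by (subst nn_integral_real_affine[where t = 0 and c = \<sigma>]) auto
  also have "\<dots> = (\<integral>\<^sup>+y. ennreal \<sigma> * (ennreal (normal_density 0 \<sigma> (\<sigma> * y)) * ennreal (min 1 (exp (sqrt 2 * (\<sigma> * y) - \<gamma> s)))) \<partial>lborel)"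
    by (rule nn_integral_cmult[symmetric]) measurable
  also have "\<dots> = (\<integral>\<^sup>+y. ennreal (std_normal_density y) * ennreal (min 1 (exp (2 * (\<sigma> / sqrt 2) * y - 2 * (\<sigma> / sqrt 2)\<^sup>2))) \<partial>lborel)"
    using \<sigma> unfolding expo by (simp add: mult.assoc[symmetric] ennreal_mult[symmetric] scale)
  also have "\<dots> = 2 * (\<integral>\<^sup>+y\<in>{\<sigma> / sqrt 2<..}. ennreal (std_normal_density y) \<partial>lborel)"
    using \<sigma> by (intro nn_integral_min_exp_std_normal) simp
  finally show ?thesis by (simp add: \<sigma>_def)
qed

text \<open>By Fubini the mean is the integral over \<open>s\<close> of the probability that \<open>W s\<close> exceeds the level. The times \<open>s\<close> with
\<open>|s|^(\<alpha>/2) / sqrt 2 < y\<close> form an interval of length \<open>2 (sqrt 2 y)^(2/\<alpha>)\<close>, which leaves a half moment of the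
standard normal law.\<close>

lemma mean_sojourn:
  "(\<integral>\<^sup>+z. ennreal (exponential_density 1 z) * (\<integral>\<^sup>+\<omega>. occupation UNIV (\<lambda>s. W s \<omega> + z) \<partial>M) \<partial>lborel)
    = ennreal (4 * Gamma (2 / \<alpha>) / Gamma (1 / \<alpha>))"
proof -
  let ?k = "\<lambda>z \<omega> s. ennreal (exponential_density 1 z) * indicator {0<..} (W s \<omega> + z)"
  have "(\<integral>\<^sup>+z. ennreal (exponential_density 1 z) * (\<integral>\<^sup>+\<omega>. occupation UNIV (\<lambda>s. W s \<omega> + z) \<partial>M) \<partial>lborel)
      = (\<integral>\<^sup>+z. (\<integral>\<^sup>+\<omega>. (\<integral>\<^sup>+s. ?k z \<omega> s \<partial>lborel) \<partial>M) \<partial>lborel)"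
  proof (rule nn_integral_cong)
    fix z
    have "ennreal (exponential_density 1 z) * (\<integral>\<^sup>+\<omega>. occupation UNIV (\<lambda>s. W s \<omega> + z) \<partial>M)
        = (\<integral>\<^sup>+\<omega>. ennreal (exponential_density 1 z) * occupation UNIV (\<lambda>s. W s \<omega> + z) \<partial>M)"
      by (rule nn_integral_cmult[symmetric]) measurable
    also have "\<dots> = (\<integral>\<^sup>+\<omega>. (\<integral>\<^sup>+s. ?k z \<omega> s \<partial>lborel) \<partial>M)"
      unfolding occupation_def
      by (intro nn_integral_cong) (subst nn_integral_cmult[symmetric], auto intro: W_path_borel)
    finally show "ennreal (exponential_density 1 z) * (\<integral>\<^sup>+\<omega>. occupation UNIV (\<lambda>s. W s \<omega> + z) \<partial>M)
      = (\<integral>\<^sup>+\<omega>. (\<integral>\<^sup>+s. ?k z \<omega> s \<partial>lborel) \<partial>M)" .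
  qed
  also have "\<dots> = (\<integral>\<^sup>+\<omega>. (\<integral>\<^sup>+z. (\<integral>\<^sup>+s. ?k z \<omega> s \<partial>lborel) \<partial>lborel) \<partial>M)"
    by (rule nn_integral_swap_M[symmetric]) measurable
  also have "\<dots> = (\<integral>\<^sup>+\<omega>. (\<integral>\<^sup>+s. (\<integral>\<^sup>+z. ?k z \<omega> s \<partial>lborel) \<partial>lborel) \<partial>M)"
    by (intro nn_integral_cong lborel_pair.Fubini') measurable
  also have "\<dots> = (\<integral>\<^sup>+s. (\<integral>\<^sup>+\<omega>. (\<integral>\<^sup>+z. ?k z \<omega> s \<partial>lborel) \<partial>M) \<partial>lborel)"
    by (rule nn_integral_swap_M) measurable
  also have "\<dots> = (\<integral>\<^sup>+s. (\<integral>\<^sup>+\<omega>. ennreal (min 1 (exp (W s \<omega>))) \<partial>M) \<partial>lborel)"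
    unfolding nn_integral_exponential_tail ..
  also have "\<dots> = (\<integral>\<^sup>+s. 2 * (\<integral>\<^sup>+y. ennreal (std_normal_density y) *
      indicator {\<bar>s\<bar> powr (\<alpha> / 2) / sqrt 2<..} y \<partial>lborel) \<partial>lborel)"
    by (rule nn_integral_cong_AE, rule AE_mp[OF AE_lborel_singleton[of 0]])
      (simp add: nn_integral_min_exp_W)
  also have "\<dots> = 2 * (\<integral>\<^sup>+s. (\<integral>\<^sup>+y. ennreal (std_normal_density y) *
      indicator {\<bar>s\<bar> powr (\<alpha> / 2) / sqrt 2<..} y \<partial>lborel) \<partial>lborel)"
    unfolding indicator_def greaterThan_iff by (rule nn_integral_cmult) measurable
  also have "(\<integral>\<^sup>+s. (\<integral>\<^sup>+y. ennreal (std_normal_density y) *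
      indicator {\<bar>s\<bar> powr (\<alpha> / 2) / sqrt 2<..} y \<partial>lborel) \<partial>lborel)
     = (\<integral>\<^sup>+y. (\<integral>\<^sup>+s. ennreal (std_normal_density y) *
      indicator {\<bar>s\<bar> powr (\<alpha> / 2) / sqrt 2<..} y \<partial>lborel) \<partial>lborel)"
    unfolding indicator_def greaterThan_iff by (rule lborel_pair.Fubini') measurable
  also have "\<dots> = (\<integral>\<^sup>+y. ennreal (2 * 2 powr (1 / \<alpha>)) *
      (ennreal (std_normal_density y * y powr (2 / \<alpha>)) * indicator {0<..} y) \<partial>lborel)"
  proof (rule nn_integral_cong)
    fix y :: real
    show "(\<integral>\<^sup>+s. ennreal (std_normal_density y) * indicator {\<bar>s\<bar> powr (\<alpha> / 2) / sqrt 2<..} y \<partial>lborel)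
      = ennreal (2 * 2 powr (1 / \<alpha>)) * (ennreal (std_normal_density y * y powr (2 / \<alpha>)) * indicator {0<..} y)"
    proof (cases "0 < y")
      case True
      define r where "r = (sqrt 2 * y) powr (2 / \<alpha>)"
      have r: "0 < r" using True by (simp add: r_def)
      have dom: "\<bar>s\<bar> powr (\<alpha> / 2) / sqrt 2 < y \<longleftrightarrow> s \<in> {- r<..<r}" for s
      proof -
        have "r powr (\<alpha> / 2) = sqrt 2 * y" using True \<alpha>_pos by (simp add: r_def powr_powr)
        then have "\<bar>s\<bar> powr (\<alpha> / 2) / sqrt 2 < y \<longleftrightarrow> \<bar>s\<bar> powr (\<alpha> / 2) < r powr (\<alpha> / 2)"
          by (simp add: field_simps)
        also have "\<dots> \<longleftrightarrow> \<bar>s\<bar> < r"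
          using powr_less_mono2[of "\<alpha> / 2" "\<bar>s\<bar>" r] powr_mono2[of "\<alpha> / 2" r "\<bar>s\<bar>"] r \<alpha>_pos
          by (cases "\<bar>s\<bar> < r") auto
        finally show ?thesis by auto
      qed
      have "(\<integral>\<^sup>+s. ennreal (std_normal_density y) * indicator {\<bar>s\<bar> powr (\<alpha> / 2) / sqrt 2<..} y \<partial>lborel)
          = (\<integral>\<^sup>+s. ennreal (std_normal_density y) * indicator {- r<..<r} s \<partial>lborel)"
        using dom by (intro nn_integral_cong) (auto simp: indicator_def)
      also have "\<dots> = ennreal (std_normal_density y) * ennreal (2 * r)"
        using r by (simp add: nn_integral_cmult_indicator)
      also have "r = 2 powr (1 / \<alpha>) * y powr (2 / \<alpha>)"
        using True by (simp add: r_def powr_mult powr_half_sqrt[symmetric] powr_powr)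
      finally show ?thesis
        using True by (simp add: ennreal_mult[symmetric] mult_ac)
    next
      case False
      have "\<not> \<bar>s\<bar> powr (\<alpha> / 2) / sqrt 2 < y" for s
      proof -
        have "0 \<le> \<bar>s\<bar> powr (\<alpha> / 2) / sqrt 2" by simp
        with False show ?thesis by linarith
      qed
      then show ?thesis using False by simp
    qed
  qed
  also have "\<dots> = ennreal (2 * 2 powr (1 / \<alpha>)) * ennreal (2 powr (2 / \<alpha> / 2) * Gamma ((2 / \<alpha> + 1) / 2) / (2 * sqrt pi))"
    using \<alpha>_pos by (subst nn_integral_cmult) (simp_all add: std_normal_half_moment)
  also have "2 * \<dots> = ennreal (4 * Gamma (2 / \<alpha>) / Gamma (1 / \<alpha>))"
  proof -
    define x where "x = 1 / \<alpha>"
    have x: "0 < x" using \<alpha>_pos by (simp add: x_def)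
    have "Gamma x * Gamma (x + 1 / 2) = 2 powr (1 - 2 * x) * sqrt pi * Gamma (2 * x)"
    proof -
      have "complex_of_real x \<notin> \<int>\<^sub>\<le>\<^sub>0" "complex_of_real x + 1 / 2 \<notin> \<int>\<^sub>\<le>\<^sub>0"
        using x by (auto elim!: nonpos_Ints_cases simp: complex_eq_iff)
      from Gamma_legendre_duplication[OF this]
      have "complex_of_real (Gamma x * Gamma (x + 1 / 2))
          = complex_of_real (exp ((1 - 2 * x) * ln 2) * sqrt pi * Gamma (2 * x))"
        by (simp add: Gamma_complex_of_real[symmetric] exp_of_real[symmetric])
      then show ?thesis unfolding of_real_eq_iff by (simp add: powr_def)
    qed
    moreover have "2 powr (1 - 2 * x) = 2 / (2 powr x * 2 powr x)"
      by (simp add: powr_diff powr_add[symmetric])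
    ultimately have "Gamma x * Gamma (x + 1 / 2) * (2 powr x * 2 powr x) = 2 * sqrt pi * Gamma (2 * x)"
      by simp
    moreover have "2 * (2 * t * (t * g / (2 * p))) = 4 * g' / g0"
      if "g0 * g * (t * t) = 2 * p * g'" "g0 \<noteq> 0" "p \<noteq> 0" for t g g' g0 p :: real
      using that by (simp add: field_simps)
    ultimately have closed_form: "2 * (2 * 2 powr x * (2 powr x * Gamma (x + 1 / 2) / (2 * sqrt pi))) = 4 * Gamma (2 * x) / Gamma x"
      using Gamma_real_pos[OF x] by simp
    have params: "2 powr (2 / \<alpha> / 2) * Gamma ((2 / \<alpha> + 1) / 2) / (2 * sqrt pi) = 2 powr x * Gamma (x + 1 / 2) / (2 * sqrt pi)"
      "Gamma (2 / \<alpha>) = Gamma (2 * x)" "1 / \<alpha> = x"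
      by (simp_all add: x_def add_divide_distrib)
    have "2 * (ennreal a * ennreal b) = ennreal (2 * (a * b))" if "0 \<le> a" "0 \<le> b" for a b
      using that by (simp add: ennreal_mult)
    from this[of "2 * 2 powr x" "2 powr x * Gamma (x + 1 / 2) / (2 * sqrt pi)"] x
    show ?thesis unfolding params closed_form[symmetric] by simp
  qed
  finally show ?thesis .
qed

end

section \<open>The sojourn time above an independent exponential level\<close>

context fbm_with_drift
begin

lemma sojourn_time_eq:
  assumes "\<omega> \<in> space M"
  shows "sojourn_time \<alpha> B y \<omega> = enn2real (occupation UNIV (\<lambda>s. W s \<omega> + y))"
proof -
  have [measurable]: "(\<lambda>s. W s \<omega> + y) \<in> borel_measurable borel" by (rule W_path_borel[OF assms])
  have "sojourn_time \<alpha> B y \<omega> = enn2real (\<integral>\<^sup>+s. ennreal (indicator {0<..} (W s \<omega> + y)) \<partial>lborel)"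
    unfolding sojourn_time_def by (rule integral_eq_nn_integral) auto
  then show ?thesis by (simp add: occupation_def ennreal_indicator)
qed

end

locale fbm_with_exponential_level = fbm_with_drift +
  fixes E :: "'a \<Rightarrow> real"
  assumes E_law: "distributed M lborel E (\<lambda>x. ennreal (exponential_density 1 x))"
    and E_indep: "indep_of_process M E (W_process \<alpha> B)"
begin

abbreviation L :: "'a \<Rightarrow> ennreal" where "L \<omega> \<equiv> occupation UNIV (\<lambda>s. W s \<omega> + E \<omega>)"

lemma E_measurable [measurable]: "E \<in> borel_measurable M"
  using distributed_measurable[OF E_law] by simp

lemma nn_integral_level:
  assumes [measurable]: "h \<in> borel_measurable borel"
  shows "(\<integral>\<^sup>+\<omega>. h (L \<omega>) \<partial>M) = (\<integral>\<^sup>+z. ennreal (exponential_density 1 z) *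
    (\<integral>\<^sup>+\<omega>. h (occupation UNIV (\<lambda>s. W s \<omega> + z)) \<partial>M) \<partial>lborel)"
proof -
  define F where "F z f = h (occupation UNIV (\<lambda>s. grid_limit f s + z))" for z f
  have F: "case_prod F \<in> borel_measurable (borel \<Otimes>\<^sub>M (\<Pi>\<^sub>M t\<in>UNIV. borel))"
    unfolding F_def by measurable
  have "F z (\<lambda>t. W t \<omega>) = h (occupation UNIV (\<lambda>s. W s \<omega> + z))" if "\<omega> \<in> space M" for z \<omega>
    using that by (simp add: F_def grid_limit_continuous continuous_W)
  then show ?thesis
    using nn_integral_indep_of_process[OF E_law W_measurable E_indep F] by (simp cong: nn_integral_cong)
qed

lemma nn_integral_inverse_L: "(\<integral>\<^sup>+\<omega>. inverse (L \<omega>) \<partial>M) = inverse_sojourn UNIV"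
  unfolding inverse_sojourn_def by (rule nn_integral_level) measurable

lemma nn_integral_L: "(\<integral>\<^sup>+\<omega>. L \<omega> \<partial>M) = ennreal (4 * Gamma (2 / \<alpha>) / Gamma (1 / \<alpha>))"
  using nn_integral_level[of "\<lambda>x. x"] mean_sojourn by simp

text \<open>The conventions \<open>1 / 0 = 0\<close> for reals and \<open>inverse 0 = \<infinity>\<close> for extended reals differ exactly where \<open>L\<close> is \<open>0\<close>. The finite
expectations of \<open>inverse L\<close> and of \<open>L\<close> exclude the degenerate values.\<close>

lemma AE_L: "AE \<omega> in M. 0 < L \<omega> \<and> L \<omega> < \<top>"
proof -
  have "inverse_sojourn UNIV < \<top>"
    using inverse_sojourn_antimono[of "{- 1..1}" UNIV] inverse_sojourn_finite by (auto intro: le_less_trans)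
  then have "AE \<omega> in M. inverse (L \<omega>) \<noteq> \<infinity>"
    by (intro nn_integral_PInf_AE) (auto simp: nn_integral_inverse_L)
  moreover have "AE \<omega> in M. L \<omega> \<noteq> \<infinity>"
    by (intro nn_integral_PInf_AE) (auto simp: nn_integral_L)
  ultimately show ?thesis
    by eventually_elim (auto simp: less_top zero_less_iff_neq_zero)
qed

lemma nn_integral_inverse_sojourn_time:
  "(\<integral>\<^sup>+\<omega>. ennreal (1 / sojourn_time \<alpha> B (E \<omega>) \<omega>) \<partial>M) = inverse_sojourn UNIV"
proof -
  have "(\<integral>\<^sup>+\<omega>. ennreal (1 / sojourn_time \<alpha> B (E \<omega>) \<omega>) \<partial>M) = (\<integral>\<^sup>+\<omega>. inverse (L \<omega>) \<partial>M)"
  proof (intro nn_integral_cong_AE, use AE_L AE_space in eventually_elim)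
    case (elim \<omega>)
    then obtain l where l: "L \<omega> = ennreal l" "0 < l"
      by (cases "L \<omega>") auto
    then show ?case
      using elim by (simp add: sojourn_time_eq inverse_ennreal inverse_eq_divide)
  qed
  then show ?thesis by (simp add: nn_integral_inverse_L)
qed

lemma sojourn_time_measurable [measurable]: "(\<lambda>\<omega>. sojourn_time \<alpha> B (E \<omega>) \<omega>) \<in> borel_measurable M"
proof -
  have "(\<lambda>\<omega>. enn2real (L \<omega>)) \<in> borel_measurable M" by measurable
  also have "?this \<longleftrightarrow> ?thesis"
    by (intro measurable_cong) (simp add: sojourn_time_eq)
  finally show ?thesis .
qed

lemma sojourn_time_nonneg: "0 \<le> sojourn_time \<alpha> B y \<omega>"
  unfolding sojourn_time_def by (rule Bochner_Integration.integral_nonneg) simp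

lemma expectation_inverse_sojourn_time:
  "expectation (\<lambda>\<omega>. 1 / sojourn_time \<alpha> B (E \<omega>) \<omega>) = enn2real (inverse_sojourn UNIV)"
  by (subst integral_eq_nn_integral)
    (auto simp: sojourn_time_nonneg nn_integral_inverse_sojourn_time)

text \<open>Jensen's inequality for the reciprocal, in the form of the tangent bound \<open>1 / l \<ge> 2 / m - l / m^2\<close> at the
mean \<open>m\<close>.\<close>

lemma expectation_inverse_sojourn_time_ge:
  "Gamma (1 / \<alpha>) / (4 * Gamma (2 / \<alpha>)) \<le> expectation (\<lambda>\<omega>. 1 / sojourn_time \<alpha> B (E \<omega>) \<omega>)"
proof -
  define T where "T \<omega> = sojourn_time \<alpha> B (E \<omega>) \<omega>" for \<omega>
  define m where "m = 4 * Gamma (2 / \<alpha>) / Gamma (1 / \<alpha>)"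
  have [measurable]: "T \<in> borel_measurable M" unfolding T_def[abs_def] by measurable
  have m: "0 < m" using \<alpha>_pos by (simp add: m_def Gamma_real_pos)
  have T_pos: "AE \<omega> in M. 0 < T \<omega>"
    using AE_L AE_space
  proof eventually_elim
    case (elim \<omega>)
    then show ?case by (simp add: T_def sojourn_time_eq enn2real_positive_iff)
  qed
  have "(\<integral>\<^sup>+\<omega>. ennreal (T \<omega>) \<partial>M) = (\<integral>\<^sup>+\<omega>. L \<omega> \<partial>M)"
    by (intro nn_integral_cong_AE, use AE_L AE_space in eventually_elim) (simp add: T_def sojourn_time_eq)
  also have "\<dots> = ennreal m" by (simp add: nn_integral_L m_def)
  finally have "has_bochner_integral M T m"
    using m by (intro has_bochner_integral_nn_integral) (auto simp: T_def sojourn_time_nonneg)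
  then have T: "integrable M T" "expectation T = m" by (simp_all add: has_bochner_integral_iff)
  have inv: "integrable M (\<lambda>\<omega>. 1 / T \<omega>)"
  proof (rule integrableI_nonneg)
    have "inverse_sojourn UNIV < \<top>"
      using inverse_sojourn_antimono[of "{- 1..1}" UNIV] inverse_sojourn_finite by (auto intro: le_less_trans)
    then show "(\<integral>\<^sup>+\<omega>. ennreal (1 / T \<omega>) \<partial>M) < \<infinity>"
      by (simp add: T_def nn_integral_inverse_sojourn_time)
  qed (auto simp: T_def sojourn_time_nonneg)
  have tangent: "2 / m - l / m\<^sup>2 \<le> 1 / l" if "0 < l" for l
  proof -
    have "1 / l - (2 / m - l / m\<^sup>2) = (l - m)\<^sup>2 / (l * m\<^sup>2)"
      using that m by (simp add: field_simps power2_eq_square)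
    moreover have "0 \<le> (l - m)\<^sup>2 / (l * m\<^sup>2)" using that by simp
    ultimately show ?thesis by linarith
  qed
  have "1 / m = 2 / m - m / m\<^sup>2" using m by (simp add: power2_eq_square field_simps)
  also have "\<dots> = expectation (\<lambda>\<omega>. 2 / m - T \<omega> / m\<^sup>2)"
    using T by (simp add: prob_space)
  also have "\<dots> \<le> expectation (\<lambda>\<omega>. 1 / T \<omega>)"
    using T_pos tangent T(1) inv by (intro integral_mono_AE) auto
  finally show ?thesis by (simp add: m_def T_def)
qed

end

section \<open>The Pickands constant as an expected reciprocal sojourn time\<close>

theorem theorem1p1:
  fixes M :: "'w measure" and \<alpha> :: real
    and B :: "real \<Rightarrow> 'w \<Rightarrow> real" and E :: "'w \<Rightarrow> real"
  assumes "0 < \<alpha>" and "\<alpha> \<le> 2"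
    and "fractional_brownian_motion M (\<alpha> / 2) B"
    and "distributed M lborel E (\<lambda>x. ennreal (exponential_density 1 x))"
    and "indep_of_process M E (W_process \<alpha> B)"
  shows "pickands_constant M \<alpha> B =
           prob_space.expectation M (\<lambda>\<omega>. 1 / sojourn_time \<alpha> B (E \<omega>) \<omega>)
       \<and> prob_space.expectation M (\<lambda>\<omega>. 1 / sojourn_time \<alpha> B (E \<omega>) \<omega>)
           \<ge> Gamma (1 / \<alpha>) / (4 * Gamma (2 / \<alpha>))"
proof -
  have "prob_space M" using assms(3) by (simp add: fractional_brownian_motion_def)
  with assms interpret fbm_with_exponential_level M \<alpha> B E
    by (simp add: fbm_with_exponential_level_def fbm_with_drift_def
        fbm_with_drift_axioms_def fbm_with_exponential_level_axioms_def)
  show ?thesis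
    using pickands_constant_eq_inverse_sojourn expectation_inverse_sojourn_time
      expectation_inverse_sojourn_time_ge by simp
qed

end
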